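(* Let $K$ and $L$ be two simplicial complexes on disjoint vertex sets, and suppose their join $K*L$ has $n$ vertices. Then for every $i\in [n]$, $$|\{S\in \Delta(K*L): [i]\cap S=\emptyset,\ |S|=\dim(K*L)+1\}|$$ $$=|\{S\in \Delta(K): [i]\cap S=\emptyset,\ |S|=\dim(K)+1\}|\cdot|\{S\in \Delta(L): [i]\cap S=\emptyset,\ |S|=\dim(L)+1\}|.$$
   Context: Simplicial complexes are finite and contain the empty set. For a complex $K$, $K_0$ denotes its vertex set. $[n]=\{1,\dots,n\}$. The join of complexes on disjoint vertex sets is $K*L=\{S\cup T: S\in K, T\in L\}$. Lexicographic order: for sets $S\ne T$ of positive integers of equal size, $S<_L T$ iff $\min(S\triangle T)\in S$. Algebraic shifting (exterior): let $K$ be a simplicial complex with vertex set contained in $[n]$ (label the vertices by positive integers if necessary). Let $V$ be a real vector space with basis $e_1,\dots,e_n$, and let $f_i=\sum_{j=1}^n\alpha_{ij}e_j$, $1\le i\le n$, where the $n^2$ real numbers $\alpha_{ij}$ are algebraically independent over $\mathbb{Q}$. For $S=\{s_1<\dots<s_k\}\subseteq[n]$ put $e_S=e_{s_1}\wedge\dots\wedge e_{s_k}$, $f_S=f_{s_1}\wedge\dots\wedge f_{s_k}$ in $\bigwedge V$, and let $\tilde f_S$ be the image of $f_S$ in $(\bigwedge V)/(e_T: T\subseteq[n],\,T\notin K)$. Then $$\Delta(K)=\{S\subseteq[n]:\ \tilde f_S\notin \mathrm{span}\{\tilde f_{S'}: |S'|=|S|,\ S'<_L S\}\}.$$ $\Delta(K)$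 does not depend on the choice of the generic matrix, of $n$, or of the vertex labelling; it is a simplicial complex with vertex set $\{1,\dots,|K_0|\}$. *)

theory Defs
  imports Complex_Main "HOL-Library.Poly_Mapping"
begin

section \<open>Finite simplicial complexes\<close>

definition finite_complex :: "'a set set \<Rightarrow> bool" where
  "finite_complex K \<longleftrightarrow>
     finite K \<and> (\<forall>S\<in>K. finite S) \<and> {} \<in> K \<and> (\<forall>S\<in>K. \<forall>T. T \<subseteq> S \<longrightarrow> T \<in> K)"

definition complex_vertices :: "'a set set \<Rightarrow> 'a set" where
  "complex_vertices K = \<Union>K"

text \<open>Integer-valued, so that the complex whose only face is the empty set has dimension \<open>-1\<close>.\<close>

definition complex_dim :: "'a set set \<Rightarrow> int" where
  "complex_dim K = int (Max (card ` K)) - 1"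

definition complex_join :: "'a set set \<Rightarrow> 'a set set \<Rightarrow> 'a set set" where
  "complex_join K L = {S \<union> T | S T. S \<in> K \<and> T \<in> L}"

definition lex_less :: "nat set \<Rightarrow> nat set \<Rightarrow> bool" where
  "lex_less S T \<longleftrightarrow> S \<noteq> T \<and> card S = card T \<and> Min (sym_diff S T) \<in> S"


section \<open>The real exterior algebra\<close>

text \<open>
  The exterior algebra of the real vector space with basis \<open>(e\<^sub>i)\<close>, \<open>i\<close> a natural number. An element
  is given by its finitely many nonzero coefficients with respect to the basis \<open>(e\<^sub>S)\<close>, \<open>S\<close> a finite
  set of naturals; the product is the wedge product, determined by
  \<open>e\<^sub>S \<and> e\<^sub>T = wedge_sign S T \<cdot> e\<^bsub>S \<union> T\<^esub>\<close> if \<open>S\<close>, \<open>T\<close> are disjoint, and \<open>0\<close> otherwise.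
  The exterior algebra of the span of \<open>e\<^sub>1, \<dots>, e\<^sub>n\<close> is a subalgebra, see \<open>ext_upto\<close> below.
\<close>

definition wedge_sign :: "nat set \<Rightarrow> nat set \<Rightarrow> real" where
  "wedge_sign S T = (-1) ^ card {(s, t). s \<in> S \<and> t \<in> T \<and> t < s}"

lemma wedge_sign_empty [simp]: "wedge_sign {} T = 1" "wedge_sign S {} = 1"
  by (simp_all add: wedge_sign_def)

lemma wedge_sign_Un_left:
  assumes "finite A" "finite B" "finite C" "A \<inter> B = {}"
  shows "wedge_sign (A \<union> B) C = wedge_sign A C * wedge_sign B C"
proof -
  let ?P = "\<lambda>X. {(s, t). s \<in> X \<and> t \<in> C \<and> t < s}"
  have eq: "?P (A \<union> B) = ?P A \<union> ?P B" by auto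
  have fin: "finite (?P A)" "finite (?P B)"
    by (rule finite_subset[of _ "A \<times> C"], use assms in auto)
       (rule finite_subset[of _ "B \<times> C"], use assms in auto)
  have "card (?P (A \<union> B)) = card (?P A) + card (?P B)"
    unfolding eq by (rule card_Un_disjoint) (use fin assms in auto)
  then show ?thesis by (simp add: wedge_sign_def power_add)
qed

lemma wedge_sign_Un_right:
  assumes "finite A" "finite B" "finite C" "B \<inter> C = {}"
  shows "wedge_sign A (B \<union> C) = wedge_sign A B * wedge_sign A C"
proof -
  let ?P = "\<lambda>X. {(s, t). s \<in> A \<and> t \<in> X \<and> t < s}"
  have eq: "?P (B \<union> C) = ?P B \<union> ?P C" by auto
  have fin: "finite (?P B)" "finite (?P C)"
    by (rule finite_subset[of _ "A \<times> B"], use assms in auto)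
       (rule finite_subset[of _ "A \<times> C"], use assms in auto)
  have "card (?P (B \<union> C)) = card (?P B) + card (?P C)"
    unfolding eq by (rule card_Un_disjoint) (use fin assms in auto)
  then show ?thesis by (simp add: wedge_sign_def power_add)
qed

definition wedge_coeff :: "(nat set \<Rightarrow> real) \<Rightarrow> (nat set \<Rightarrow> real) \<Rightarrow> nat set \<Rightarrow> real" where
  "wedge_coeff a b U = (\<Sum>S\<in>Pow U. wedge_sign S (U - S) * a S * b (U - S))"

lemma wedge_coeff_assoc:
  "wedge_coeff (wedge_coeff a b) c U = wedge_coeff a (wedge_coeff b c) U"
proof (cases "finite U")
  case False
  then show ?thesis by (simp add: wedge_coeff_def)
next
  case True
  have "wedge_coeff (wedge_coeff a b) c U =
     (\<Sum>X\<in>Pow U. \<Sum>S\<in>Pow X. wedge_sign X (U - X) * wedge_sign S (X - S) * a S * b (X - S) * c (U - X))"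
    by (simp add: wedge_coeff_def sum_distrib_left sum_distrib_right mult.assoc)
  also have "\<dots> = (\<Sum>(X, S)\<in>Sigma (Pow U) Pow.
      wedge_sign X (U - X) * wedge_sign S (X - S) * a S * b (X - S) * c (U - X))"
    by (rule sum.Sigma) (use True in \<open>auto intro: finite_subset\<close>)
  also have "\<dots> = (\<Sum>(S, Y)\<in>Sigma (Pow U) (\<lambda>S. Pow (U - S)).
      wedge_sign S (U - S) * wedge_sign Y (U - S - Y) * a S * b Y * c (U - S - Y))"
  proof (rule sum.reindex_bij_witness[where i = "\<lambda>(S, Y). (S \<union> Y, S)"
        and j = "\<lambda>(X, S). (S, X - S)"], goal_cases)
    case (5 p)
    obtain X S where p: "p = (X, S)" by force
    with 5 have XS: "S \<subseteq> X" "X \<subseteq> U" by auto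
    note fin = finite_subset[OF XS(2) True] finite_subset[OF XS(1) finite_subset[OF XS(2) True]]
    have 1: "wedge_sign X (U - X) = wedge_sign S (U - X) * wedge_sign (X - S) (U - X)"
      using wedge_sign_Un_left[of S "X - S" "U - X"] XS fin True by (simp add: Un_absorb1)
    have 2: "(X - S) \<union> (U - X) = U - S" using XS by auto
    have 3: "wedge_sign S (U - S) = wedge_sign S (X - S) * wedge_sign S (U - X)"
      using wedge_sign_Un_right[of S "X - S" "U - X"] XS fin True unfolding 2 by auto
    have 4: "U - S - (X - S) = U - X" using XS by auto
    show ?case by (simp add: p 1 3 4)
  qed auto
  also have "\<dots> = (\<Sum>S\<in>Pow U. \<Sum>Y\<in>Pow (U - S).
      wedge_sign S (U - S) * wedge_sign Y (U - S - Y) * a S * b Y * c (U - S - Y))"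
    by (rule sum.Sigma[symmetric]) (use True in auto)
  also have "\<dots> = wedge_coeff a (wedge_coeff b c) U"
    by (simp add: wedge_coeff_def sum_distrib_left mult_ac)
  finally show ?thesis .
qed

lemma wedge_coeff_one_left:
  assumes "finite U"
  shows "wedge_coeff (\<lambda>S. if S = {} then 1 else 0) a U = a U"
proof -
  have "wedge_coeff (\<lambda>S. if S = {} then 1 else 0) a U = (\<Sum>S\<in>Pow U. if S = {} then a U else 0)"
    unfolding wedge_coeff_def by (rule sum.cong) auto
  then show ?thesis using assms by simp
qed

lemma wedge_coeff_one_right:
  assumes "finite U"
  shows "wedge_coeff a (\<lambda>S. if S = {} then 1 else 0) U = a U"
proof -
  have "wedge_coeff a (\<lambda>S. if S = {} then 1 else 0) U = (\<Sum>S\<in>Pow U. if S = U then a U else 0)"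
    unfolding wedge_coeff_def by (rule sum.cong) auto
  then show ?thesis using assms by simp
qed

definition ext_coeffs :: "(nat set \<Rightarrow> real) set" where
  "ext_coeffs = {a. finite {S. a S \<noteq> 0} \<and> (\<forall>S. a S \<noteq> 0 \<longrightarrow> finite S)}"

lemma wedge_coeff_in_ext_coeffs:
  assumes "a \<in> ext_coeffs" "b \<in> ext_coeffs"
  shows "wedge_coeff a b \<in> ext_coeffs"
proof -
  let ?A = "{S. a S \<noteq> 0}" and ?B = "{S. b S \<noteq> 0}"
  have fin: "finite ?A" "finite ?B" using assms by (auto simp: ext_coeffs_def)
  have "U \<in> (\<lambda>(S, T). S \<union> T) ` (?A \<times> ?B)" if "wedge_coeff a b U \<noteq> 0" for U
  proof -
    from that obtain S where "S \<in> Pow U" "wedge_sign S (U - S) * a S * b (U - S) \<noteq> 0"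
      unfolding wedge_coeff_def by (meson sum.neutral)
    then show ?thesis by (intro image_eqI[where x = "(S, U - S)"]) auto
  qed
  then have "{U. wedge_coeff a b U \<noteq> 0} \<subseteq> (\<lambda>(S, T). S \<union> T) ` (?A \<times> ?B)" by blast
  then have "finite {U. wedge_coeff a b U \<noteq> 0}" using fin by (auto intro: finite_subset)
  moreover have "finite U" if "wedge_coeff a b U \<noteq> 0" for U
    using that by (rule contrapos_np) (simp add: wedge_coeff_def)
  ultimately show ?thesis by (simp add: ext_coeffs_def)
qed

lemma ext_coeffs_combine:
  assumes "a \<in> ext_coeffs" "b \<in> ext_coeffs" "f 0 0 = 0"
  shows "(\<lambda>S. f (a S) (b S)) \<in> ext_coeffs"
proof -
  have nz: "a S \<noteq> 0 \<or> b S \<noteq> 0" if "f (a S) (b S) \<noteq> 0" for S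
    using that assms(3) by (cases "a S = 0") auto
  then have "{S. f (a S) (b S) \<noteq> 0} \<subseteq> {S. a S \<noteq> 0} \<union> {S. b S \<noteq> 0}" by blast
  moreover have "finite ({S. a S \<noteq> 0} \<union> {S. b S \<noteq> 0})"
    using assms by (simp add: ext_coeffs_def)
  ultimately have "finite {S. f (a S) (b S) \<noteq> 0}" by (rule finite_subset)
  with nz assms show ?thesis unfolding ext_coeffs_def by blast
qed

typedef ext_alg = ext_coeffs
  morphisms ext_coeff Abs_ext_alg
  by (rule exI[of _ "\<lambda>_. 0"]) (simp add: ext_coeffs_def)

setup_lifting type_definition_ext_alg

lemma infinite_ext_coeff: "infinite U \<Longrightarrow> ext_coeff a U = 0"
  using ext_coeff[of a] by (auto simp: ext_coeffs_def)

lemma ext_alg_eqI: "(\<And>U. finite U \<Longrightarrow> ext_coeff a U = ext_coeff b U) \<Longrightarrow> a = b"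
  by (metis ext ext_coeff_inject infinite_ext_coeff)

instantiation ext_alg :: real_algebra_1
begin

lift_definition zero_ext_alg :: ext_alg is "\<lambda>_. 0"
  by (simp add: ext_coeffs_def)

lift_definition one_ext_alg :: ext_alg is "\<lambda>S. if S = {} then 1 else 0"
  by (simp add: ext_coeffs_def)

lift_definition plus_ext_alg :: "ext_alg \<Rightarrow> ext_alg \<Rightarrow> ext_alg" is "\<lambda>a b S. a S + b S"
  by (rule ext_coeffs_combine) simp_all

lift_definition uminus_ext_alg :: "ext_alg \<Rightarrow> ext_alg" is "\<lambda>a S. - a S"
  by (simp add: ext_coeffs_def)

lift_definition minus_ext_alg :: "ext_alg \<Rightarrow> ext_alg \<Rightarrow> ext_alg" is "\<lambda>a b S. a S - b S"
  by (rule ext_coeffs_combine) simp_all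

lift_definition scaleR_ext_alg :: "real \<Rightarrow> ext_alg \<Rightarrow> ext_alg" is "\<lambda>r a S. r * a S"
  by (auto simp: ext_coeffs_def elim: finite_subset[rotated])

lift_definition times_ext_alg :: "ext_alg \<Rightarrow> ext_alg \<Rightarrow> ext_alg" is wedge_coeff
  by (rule wedge_coeff_in_ext_coeffs)

instance
proof
  fix a b c :: ext_alg and r s :: real
  show "a + b + c = a + (b + c)" by transfer (simp add: add.assoc)
  show "a + b = b + a" by transfer (simp add: add.commute)
  show "0 + a = a" by transfer simp
  show "- a + a = 0" by transfer simp
  show "a - b = a + - b" by transfer simp
  show "r *\<^sub>R (a + b) = r *\<^sub>R a + r *\<^sub>R b" by transfer (simp add: distrib_left)
  show "(r + s) *\<^sub>R a = r *\<^sub>R a + s *\<^sub>R a" by transfer (simp add: distrib_right)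
  show "r *\<^sub>R s *\<^sub>R a = (r * s) *\<^sub>R a" by transfer (simp add: mult.assoc)
  show "1 *\<^sub>R a = a" by transfer simp
  show "a * b * c = a * (b * c)" by transfer (rule ext, rule wedge_coeff_assoc)
  show "1 * a = a"
    by (rule ext_alg_eqI) (simp add: times_ext_alg.rep_eq one_ext_alg.rep_eq wedge_coeff_one_left)
  show "a * 1 = a"
    by (rule ext_alg_eqI) (simp add: times_ext_alg.rep_eq one_ext_alg.rep_eq wedge_coeff_one_right)
  show "(a + b) * c = a * c + b * c"
    by transfer (simp add: fun_eq_iff wedge_coeff_def sum.distrib[symmetric] algebra_simps)
  show "a * (b + c) = a * b + a * c"
    by transfer (simp add: fun_eq_iff wedge_coeff_def sum.distrib[symmetric] algebra_simps)
  show "r *\<^sub>R a * b = r *\<^sub>R (a * b)"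
    by transfer (simp add: fun_eq_iff wedge_coeff_def sum_distrib_left mult_ac)
  show "a * r *\<^sub>R b = r *\<^sub>R (a * b)"
    by transfer (simp add: fun_eq_iff wedge_coeff_def sum_distrib_left mult_ac)
  show "(0 :: ext_alg) \<noteq> 1" by transfer (metis zero_neq_one)
qed

end

lift_definition ext_gen :: "nat \<Rightarrow> ext_alg" is "\<lambda>i S. if S = {i} then 1 else 0"
  by (simp add: ext_coeffs_def)

text \<open>The wedge product of \<open>g s\<close>, \<open>s \<in> S\<close>, in increasing order of \<open>s\<close>.\<close>

definition wedge_set :: "(nat \<Rightarrow> ext_alg) \<Rightarrow> nat set \<Rightarrow> ext_alg" where
  "wedge_set g S = prod_list (map g (sorted_list_of_set S))"

abbreviation ext_basis :: "nat set \<Rightarrow> ext_alg" where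
  "ext_basis \<equiv> wedge_set ext_gen"

lemma ext_coeff_gen_times:
  assumes "finite U"
  shows "ext_coeff (ext_gen i * a) U =
    (if i \<in> U then wedge_sign {i} (U - {i}) * ext_coeff a (U - {i}) else 0)"
proof -
  have "ext_coeff (ext_gen i * a) U =
      (\<Sum>S\<in>Pow U. if S = {i} then wedge_sign {i} (U - {i}) * ext_coeff a (U - {i}) else 0)"
    unfolding times_ext_alg.rep_eq wedge_coeff_def ext_gen.rep_eq by (rule sum.cong) auto
  then show ?thesis using assms by simp
qed

text \<open>
  The products of the generators in increasing order are indeed the elements with respect to which
  the coefficients \<open>ext_coeff\<close> are taken.
\<close>

lemma ext_coeff_basis:
  assumes "finite S"
  shows "ext_coeff (ext_basis S) U = (if U = S then 1 else 0)"
proof -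
  have "ext_coeff (prod_list (map ext_gen xs)) U = (if U = set xs then 1 else 0)"
    if "sorted xs" "distinct xs" for xs U
    using that
  proof (induction xs arbitrary: U)
    case Nil
    then show ?case by (simp add: one_ext_alg.rep_eq)
  next
    case (Cons x xs)
    show ?case
    proof (cases "finite U")
      case False
      then show ?thesis by (auto simp: infinite_ext_coeff)
    next
      case True
      have none: "{(s, t). s = x \<and> t \<in> set xs \<and> t < s} = {}"
        using Cons.prems by fastforce
      have sgn: "wedge_sign {x} (set xs) = 1"
        by (simp add: wedge_sign_def none)
      have iff: "x \<in> U \<and> U - {x} = set xs \<longleftrightarrow> U = insert x (set xs)"
        using Cons.prems by auto
      show ?thesis
        using Cons iff sgn by (auto simp: ext_coeff_gen_times[OF True])
    qed
  qed
  from this[of "sorted_list_of_set S"] assms show ?thesis by (simp add: wedge_set_def)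
qed


section \<open>Exterior algebraic shifting\<close>

text \<open>
  A polynomial over \<open>\<rat>\<close> in variables indexed by \<open>'i\<close> is a finitely supported map from monomials
  to coefficients, a monomial being a finitely supported map from variables to exponents.
\<close>

definition rat_poly_eval :: "('i \<Rightarrow> real) \<Rightarrow> (('i \<Rightarrow>\<^sub>0 nat) \<Rightarrow>\<^sub>0 rat) \<Rightarrow> real" where
  "rat_poly_eval x p =
     (\<Sum>m\<in>Poly_Mapping.keys p. of_rat (Poly_Mapping.lookup p m) *
        (\<Prod>i\<in>Poly_Mapping.keys m. x i ^ Poly_Mapping.lookup m i))"

definition alg_independent_over_rat :: "'i set \<Rightarrow> ('i \<Rightarrow> real) \<Rightarrow> bool" where
  "alg_independent_over_rat I x \<longleftrightarrow>
     (\<forall>p :: ('i \<Rightarrow>\<^sub>0 nat) \<Rightarrow>\<^sub>0 rat.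
        (\<forall>m\<in>Poly_Mapping.keys p. Poly_Mapping.keys m \<subseteq> I) \<and> rat_poly_eval x p = 0 \<longrightarrow> p = 0)"

definition generic_matrix :: "nat \<Rightarrow> (nat \<Rightarrow> nat \<Rightarrow> real) \<Rightarrow> bool" where
  "generic_matrix n \<alpha> \<longleftrightarrow> alg_independent_over_rat ({1..n} \<times> {1..n}) (\<lambda>(i, j). \<alpha> i j)"

text \<open>The exterior algebra of the span of \<open>e\<^sub>1, \<dots>, e\<^sub>n\<close>.\<close>

definition ext_upto :: "nat \<Rightarrow> ext_alg set" where
  "ext_upto n = span (ext_basis ` Pow {1..n})"

text \<open>The two-sided ideal of \<open>ext_upto n\<close> generated by the non-faces of \<open>K\<close> contained in \<open>[n]\<close>.\<close>

definition nonface_ideal :: "nat \<Rightarrow> nat set set \<Rightarrow> ext_alg set" where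
  "nonface_ideal n K =
     span {a * ext_basis T * b | a T b.
             a \<in> ext_upto n \<and> b \<in> ext_upto n \<and> T \<subseteq> {1..n} \<and> T \<notin> K}"

definition generic_form :: "nat \<Rightarrow> (nat \<Rightarrow> nat \<Rightarrow> real) \<Rightarrow> nat \<Rightarrow> ext_alg" where
  "generic_form n \<alpha> i = (\<Sum>j=1..n. \<alpha> i j *\<^sub>R ext_gen j)"

text \<open>
  The quotient by \<open>nonface_ideal n K\<close> is not formed as a type: the class of \<open>x\<close> lies in the span of
  the classes of the elements of \<open>B\<close> iff \<open>x\<close> is congruent, modulo the ideal, to an element of the
  span of \<open>B\<close>.
\<close>

definition shift_matrix :: "nat \<Rightarrow> (nat \<Rightarrow> nat \<Rightarrow> real) \<Rightarrow> nat set set \<Rightarrow> nat set set" where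
  "shift_matrix n \<alpha> K =
     {S. S \<subseteq> {1..n} \<and>
         \<not> (\<exists>w \<in> span {wedge_set (generic_form n \<alpha>) S' | S'.
                         S' \<subseteq> {1..n} \<and> card S' = card S \<and> lex_less S' S}.
              wedge_set (generic_form n \<alpha>) S - w \<in> nonface_ideal n K)}"

text \<open>
  The shifted complex \<open>\<Delta>(K)\<close> does not depend on the auxiliary choices: \<open>n\<close>, a labelling of the
  vertices of \<open>K\<close> by elements of \<open>[n]\<close>, and a generic \<open>n \<times> n\<close> matrix. The predicate says that \<open>D\<close> is
  \<open>\<Delta>(K)\<close> as computed from some such choices, so a statement for all \<open>D\<close> with
  \<open>is_exterior_shift K D\<close> is a statement about \<open>\<Delta>(K)\<close> for every choice.
\<close>

definition is_exterior_shift :: "'a set set \<Rightarrow> nat set set \<Rightarrow> bool" where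
  "is_exterior_shift K D \<longleftrightarrow>
     (\<exists>n label \<alpha>. inj_on label (complex_vertices K) \<and> label ` complex_vertices K \<subseteq> {1..n} \<and>
        generic_matrix n \<alpha> \<and> D = shift_matrix n \<alpha> ((`) label ` K))"

end

theory Submission
  imports Defs
begin

text \<open>
  Write \<open>d = dim K + 1\<close>. Modulo the non-faces of \<open>K\<close>, the products \<open>f\<^sub>S\<close>, \<open>S \<in> \<Delta>(K)\<close>, \<open>|S| = d\<close>, form a
  basis in degree \<open>d\<close>, and those with \<open>S\<close> meeting \<open>[i]\<close> span the part generated by \<open>f\<^sub>1, \<dots>, f\<^sub>i\<close>. So the
  number of \<open>S \<in> \<Delta>(K)\<close> with \<open>|S| = d\<close> and \<open>S \<inter> [i] = {}\<close> is the dimension of the annihilator of that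
  part, which is the space of \<open>d\<close>-chains of \<open>K\<close> killed by the weighted boundary operators dual to
  multiplication by \<open>f\<^sub>1, \<dots>, f\<^sub>i\<close>. On top-dimensional chains of \<open>K * L\<close> such a boundary operator has two
  components of different bidegree, so the space for the join is the tensor product of the spaces
  for \<open>K\<close> and \<open>L\<close>. The dimension does not depend on the generic matrix, since Gaussian elimination
  only asks which polynomials in the entries vanish.
\<close>

section \<open>Homogeneous linear systems\<close>

text \<open>Nothing in the statement makes the three shifts compatible: each may come from its own
  matrix, labelling and ambient size. The choices made for the join restrict to the vertices of each
  factor and are admissible there, so only the factors' own choices have to be exchanged. This is
  done at the level of cycle spaces: in a division-free elimination two generic systems show the
  same zero pattern throughout, and so even have the same free columns.

  The bidegree argument relies on both degrees being maximal: a vertex of \<open>L\<close> added to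
  a top face \<open>B\<close> of \<open>L\<close> leaves the complex, so a boundary coefficient at
  \<open>U \<union> B\<close> only sees vertices of \<open>K\<close>. A cycle of the join thus lies
  in Z(K) tensor C(L) and in C(K) tensor Z(L), where Z denotes cycles and C all chains of top
  degree, and the intersection is Z(K) tensor Z(L). Dimensions are handled through
  \<open>coordinates\<close>: functionals on a space whose values can be prescribed freely and
  determine the element.\<close>

definition null_space :: "'r set \<Rightarrow> 'c set \<Rightarrow> ('r \<Rightarrow> 'c \<Rightarrow> real) \<Rightarrow> ('c \<Rightarrow> real) set" where
  "null_space R T M =
     {\<phi>. (\<forall>t. t \<notin> T \<longrightarrow> \<phi> t = 0) \<and> (\<forall>r\<in>R. (\<Sum>t\<in>T. M r t * \<phi> t) = 0)}"

text \<open>Cross-multiplying instead of dividing keeps every entry an integer polynomial in the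
  original entries, so an invariant closed under products and differences survives
  elimination.\<close>

definition eliminate :: "('r \<Rightarrow> 'c \<Rightarrow> real) \<Rightarrow> 'r \<Rightarrow> 'c \<Rightarrow> 'r \<Rightarrow> 'c \<Rightarrow> real" where
  "eliminate M r t r' s = M r t * M r' s - M r' t * M r s"

text \<open>Row \<open>r\<close> determines \<open>\<phi> t\<close> from the other values;
  substituting it into row \<open>r'\<close> and clearing the denominator \<open>M r t\<close> gives
  the reduced row. The value at \<open>t\<close> is reset to 0 because vectors of the smaller system
  must vanish outside \<open>T - {t}\<close>.\<close>

lemma null_space_eliminate:
  assumes "finite T" "t \<in> T" "r \<in> R" "M r t \<noteq> 0"
  shows "\<phi> \<in> null_space R T M \<longleftrightarrow>
     \<phi>(t := 0) \<in> null_space (R - {r}) (T - {t}) (eliminate M r t) \<and>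
     \<phi> t = - (\<Sum>s\<in>T - {t}. M r s * \<phi> s) / M r t"
proof -
  define S where "S r' = (\<Sum>s\<in>T - {t}. M r' s * \<phi> s)" for r'
  have row: "(\<Sum>s\<in>T. M r' s * \<phi> s) = M r' t * \<phi> t + S r'" for r'
    unfolding S_def using assms by (simp add: sum.remove)
  have "(\<Sum>s\<in>T - {t}. eliminate M r t r' s * (\<phi>(t := 0)) s) = M r t * S r' - M r' t * S r" for r'
  proof -
    have "(\<Sum>s\<in>T - {t}. eliminate M r t r' s * (\<phi>(t := 0)) s) =
      (\<Sum>s\<in>T - {t}. M r t * (M r' s * \<phi> s) - M r' t * (M r s * \<phi> s))"
      by (rule sum.cong) (auto simp: eliminate_def algebra_simps)
    then show ?thesis by (simp add: sum_subtractf S_def sum_distrib_left)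
  qed
  then have A: "\<phi>(t := 0) \<in> null_space (R - {r}) (T - {t}) (eliminate M r t) \<longleftrightarrow>
     (\<forall>s. s \<notin> T \<longrightarrow> \<phi> s = 0) \<and> (\<forall>r'\<in>R - {r}. M r t * S r' - M r' t * S r = 0)"
    using assms by (simp add: null_space_def del: fun_upd_apply) (metis fun_upd_apply)
  have B: "\<phi> t = - S r / M r t \<longleftrightarrow> M r t * \<phi> t + S r = 0"
    using assms by (auto simp: field_simps)
  have C: "M r' t * \<phi> t + S r' = 0 \<longleftrightarrow> M r t * S r' - M r' t * S r = 0"
    if "M r t * \<phi> t + S r = 0" for r'
  proof -
    have "M r t * (M r' t * \<phi> t + S r') = M r t * S r' - M r' t * S r"
      using that by algebra
    then show ?thesis using assms by (metis mult_eq_0_iff)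
  qed
  have "\<phi> \<in> null_space R T M \<longleftrightarrow>
      (\<forall>s. s \<notin> T \<longrightarrow> \<phi> s = 0) \<and> (\<forall>r'\<in>R. M r' t * \<phi> t + S r' = 0)"
    by (simp add: null_space_def row)
  then show ?thesis unfolding A S_def[symmetric] B using C assms(3) by blast
qed

lemma null_space_trivial_eliminate:
  assumes "finite T" "t \<in> T" "r \<in> R" "M r t \<noteq> 0"
  shows "null_space R T M \<subseteq> {\<lambda>_. 0} \<longleftrightarrow>
    null_space (R - {r}) (T - {t}) (eliminate M r t) \<subseteq> {\<lambda>_. 0}"
proof
  assume L: "null_space R T M \<subseteq> {\<lambda>_. 0}"
  show "null_space (R - {r}) (T - {t}) (eliminate M r t) \<subseteq> {\<lambda>_. 0}"
  proof
    fix \<phi> assume \<phi>: "\<phi> \<in> null_space (R - {r}) (T - {t}) (eliminate M r t)"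
    let ?\<psi> = "\<phi>(t := - (\<Sum>s\<in>T - {t}. M r s * \<phi> s) / M r t)"
    have "\<phi> t = 0" using \<phi> by (simp add: null_space_def)
    then have "?\<psi>(t := 0) = \<phi>" by auto
    then have "?\<psi> \<in> null_space R T M"
      using \<phi> by (subst null_space_eliminate[where M = M, OF assms]) auto
    with L have "?\<psi> = (\<lambda>_. 0)" by auto
    then have "\<phi> s = 0" for s using \<open>\<phi> t = 0\<close> by (cases "s = t") (auto dest: fun_cong[of _ _ s])
    then show "\<phi> \<in> {\<lambda>_. 0}" by auto
  qed
next
  assume R: "null_space (R - {r}) (T - {t}) (eliminate M r t) \<subseteq> {\<lambda>_. 0}"
  show "null_space R T M \<subseteq> {\<lambda>_. 0}"
  proof
    fix \<phi> assume \<phi>: "\<phi> \<in> null_space R T M"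
    then have *: "\<phi>(t := 0) \<in> null_space (R - {r}) (T - {t}) (eliminate M r t)"
      and t: "\<phi> t = - (\<Sum>s\<in>T - {t}. M r s * \<phi> s) / M r t"
      using null_space_eliminate[where M = M, OF assms] by auto
    from * R have "\<phi>(t := 0) = (\<lambda>_. 0)" by auto
    then have z: "\<phi> s = 0" if "s \<noteq> t" for s using that by (auto dest: fun_cong[of _ _ s])
    with t have "\<phi> t = 0" by simp
    with z have "\<phi> s = 0" for s by (cases "s = t") auto
    then show "\<phi> \<in> {\<lambda>_. 0}" by auto
  qed
qed

text \<open>If column \<open>t\<close> vanished on all of \<open>R\<close>, the unit vector at
  \<open>t\<close> would be a nonzero solution.\<close>

lemma null_space_trivial_pivot:
  assumes "finite T" "null_space R T M \<subseteq> {\<lambda>_. 0}" "t \<in> T"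
  obtains r where "r \<in> R" "M r t \<noteq> 0"
proof -
  have "\<exists>r\<in>R. M r t \<noteq> 0"
  proof (rule ccontr)
    assume "\<not> ?thesis"
    then have "(\<Sum>s\<in>T. M r s * (if s = t then 1 else 0)) = 0" if "r \<in> R" for r
      using that assms by (simp add: if_distrib cong: if_cong)
    then have "(\<lambda>s. if s = t then 1 else 0 :: real) \<in> null_space R T M"
      using assms(3) unfolding null_space_def by auto
    with assms(2) have "(\<lambda>s. if s = t then 1 else 0 :: real) = (\<lambda>_. 0)" by blast
    then show False by (auto dest: fun_cong[of _ _ t])
  qed
  with that show ?thesis by blast
qed

text \<open>Each elimination step removes one row and one column, and a pivot exists as long as
  columns remain. The comparison of dimensions in \<open>coordinates_card_le\<close> rests on this
  count.\<close>

lemma null_space_trivial_card: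
  assumes "finite T" "finite R" "null_space R T M \<subseteq> {\<lambda>_. 0}"
  shows "card T \<le> card R"
  using assms
proof (induction T arbitrary: R M rule: finite_psubset_induct)
  case (psubset T)
  show ?case
  proof (cases "T = {}")
    case False
    then obtain t where t: "t \<in> T" by auto
    obtain r where r: "r \<in> R" "M r t \<noteq> 0"
      using null_space_trivial_pivot[OF psubset.hyps psubset.prems(2) t] .
    have "card (T - {t}) \<le> card (R - {r})"
    proof (rule psubset.IH)
      show "T - {t} \<subset> T" using t by auto
      show "finite (R - {r})" using psubset.prems by simp
      show "null_space (R - {r}) (T - {t}) (eliminate M r t) \<subseteq> {\<lambda>_. 0}"
        using null_space_trivial_eliminate[OF psubset.hyps t, where M = M, OF r] psubset.prems by auto
    qed
    moreover have "card T > 0" "card R > 0"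
      using t r psubset by (auto simp: card_gt_0_iff)
    ultimately show ?thesis
      using t r psubset by (simp add: card_Diff_singleton)
  qed simp
qed

text \<open>A pair in \<open>P\<close> is to be read as a quantity and its specialization: a nonzero
  specialization forces a nonzero quantity. Hence each pivot of \<open>N\<close> is also a pivot of
  \<open>M\<close>, and the elimination of \<open>N\<close> can be copied on
  \<open>M\<close>.\<close>

lemma null_space_trivial_specialize:
  assumes "finite T"
    and "\<And>a b a' b'. (a, b) \<in> P \<Longrightarrow> (a', b') \<in> P \<Longrightarrow> (a * a', b * b') \<in> P"
    and "\<And>a b a' b'. (a, b) \<in> P \<Longrightarrow> (a', b') \<in> P \<Longrightarrow> (a - a', b - b') \<in> P"
    and "\<And>b. (0, b) \<in> P \<Longrightarrow> b = 0"
    and "\<And>r t. r \<in> R \<Longrightarrow> t \<in> T \<Longrightarrow> (M r t, N r t) \<in> P"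
    and "null_space R T N \<subseteq> {\<lambda>_. 0}"
  shows "null_space R T M \<subseteq> {\<lambda>_. 0}"
  using assms(1,5,6)
proof (induction T arbitrary: R M N rule: finite_psubset_induct)
  case (psubset T)
  show ?case
  proof (cases "T = {}")
    case True
    then show ?thesis by (auto simp: null_space_def)
  next
    case False
    then obtain t where t: "t \<in> T" by auto
    obtain r where r: "r \<in> R" "N r t \<noteq> 0"
      using null_space_trivial_pivot[OF psubset.hyps psubset.prems(2) t] .
    then have M: "M r t \<noteq> 0" using psubset.prems(1)[OF r(1) t] assms(4) by metis
    have "null_space (R - {r}) (T - {t}) (eliminate M r t) \<subseteq> {\<lambda>_. 0}"
    proof (rule psubset.IH)
      show "T - {t} \<subset> T" using t by auto
      show "(eliminate M r t r' s, eliminate N r t r' s) \<in> P" if "r' \<in> R - {r}" "s \<in> T - {t}" for r' s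
        unfolding eliminate_def using that t r by (intro assms(2,3) psubset.prems) auto
      show "null_space (R - {r}) (T - {t}) (eliminate N r t) \<subseteq> {\<lambda>_. 0}"
        using null_space_trivial_eliminate[OF psubset.hyps t, where M = N, OF r] psubset.prems by auto
    qed
    then show ?thesis
      using null_space_trivial_eliminate[OF psubset.hyps t, where M = M, OF r(1) M] by auto
  qed
qed

text \<open>For linear functionals on a subspace \<open>W\<close> this says that they restrict to a
  basis of the dual, so that a finite \<open>B\<close> has as many elements as the dimension of
  \<open>W\<close>. A general family \<open>\<kappa>\<close> covers both entries of a vector and
  pairings with products of forms.\<close>

definition coordinates :: "('c \<Rightarrow> real) set \<Rightarrow> 'b set \<Rightarrow> ('b \<Rightarrow> ('c \<Rightarrow> real) \<Rightarrow> real) \<Rightarrow> bool" where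
  "coordinates W B \<kappa> \<longleftrightarrow> (\<forall>g. \<exists>!\<phi>. \<phi> \<in> W \<and> (\<forall>b\<in>B. \<kappa> b \<phi> = g b))"

definition evaluation :: "'c \<Rightarrow> ('c \<Rightarrow> real) \<Rightarrow> real" where
  [simp]: "evaluation t \<phi> = \<phi> t"

lemma coordinates_obtain:
  assumes "coordinates W B \<kappa>"
  obtains \<phi> where "\<phi> \<in> W" "\<And>b. b \<in> B \<Longrightarrow> \<kappa> b \<phi> = g b"
proof -
  have "\<exists>!\<phi>. \<phi> \<in> W \<and> (\<forall>b\<in>B. \<kappa> b \<phi> = g b)"
    using assms unfolding coordinates_def by (rule spec)
  with that show ?thesis by blast
qed

lemma coordinates_unique:
  assumes "coordinates W B \<kappa>" "\<phi> \<in> W" "\<psi> \<in> W" "\<And>b. b \<in> B \<Longrightarrow> \<kappa> b \<phi> = \<kappa> b \<psi>"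
  shows "\<phi> = \<psi>"
proof -
  have "\<exists>!\<chi>. \<chi> \<in> W \<and> (\<forall>b\<in>B. \<kappa> b \<chi> = \<kappa> b \<psi>)"
    using assms(1) unfolding coordinates_def by (rule spec)
  then obtain \<chi> where "\<And>\<theta>. \<theta> \<in> W \<and> (\<forall>b\<in>B. \<kappa> b \<theta> = \<kappa> b \<psi>) \<Longrightarrow> \<theta> = \<chi>" by auto
  from this[of \<phi>] this[of \<psi>] show ?thesis using assms(2-4) by auto
qed

lemma coordinatesI:
  assumes "\<And>g. \<exists>\<phi>. \<phi> \<in> W \<and> (\<forall>b\<in>B. \<kappa> b \<phi> = g b)"
    and "\<And>\<phi> \<psi>. \<phi> \<in> W \<Longrightarrow> \<psi> \<in> W \<Longrightarrow> (\<And>b. b \<in> B \<Longrightarrow> \<kappa> b \<phi> = \<kappa> b \<psi>) \<Longrightarrow> \<phi> = \<psi>"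
  shows "coordinates W B \<kappa>"
  unfolding coordinates_def
proof
  fix g
  obtain \<phi> where "\<phi> \<in> W" "\<forall>b\<in>B. \<kappa> b \<phi> = g b" using assms(1) by blast
  then show "\<exists>!\<phi>. \<phi> \<in> W \<and> (\<forall>b\<in>B. \<kappa> b \<phi> = g b)"
    by (intro ex1I[of _ \<phi>] conjI assms(2)) auto
qed

text \<open>Passing to the reduced system only drops the entry at \<open>t\<close>, which is
  recovered from the others; as \<open>t\<close> is not in \<open>B\<close>, the same entries remain
  free and determining.\<close>

lemma coordinates_eliminate:
  assumes "finite T" "t \<in> T" "r \<in> R" "M r t \<noteq> 0" "B \<subseteq> T - {t}"
    and "coordinates (null_space (R - {r}) (T - {t}) (eliminate M r t)) B evaluation"
  shows "coordinates (null_space R T M) B evaluation"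
proof (rule coordinatesI)
  let ?W = "null_space (R - {r}) (T - {t}) (eliminate M r t)"
  note E = null_space_eliminate[where M = M, OF assms(1-4)]
  show "\<exists>\<psi>. \<psi> \<in> null_space R T M \<and> (\<forall>b\<in>B. evaluation b \<psi> = g b)" for g
  proof -
    obtain \<phi> where \<phi>: "\<phi> \<in> ?W" "\<And>b. b \<in> B \<Longrightarrow> evaluation b \<phi> = g b"
      using coordinates_obtain[OF assms(6)] by blast
    let ?\<psi> = "\<phi>(t := - (\<Sum>s\<in>T - {t}. M r s * \<phi> s) / M r t)"
    have "\<phi> t = 0" using \<phi> by (simp add: null_space_def)
    then have "?\<psi>(t := 0) = \<phi>" by auto
    then have "?\<psi> \<in> null_space R T M" using \<phi> by (subst E) auto
    moreover have "\<forall>b\<in>B. evaluation b ?\<psi> = g b" using \<phi> assms(5) by auto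
    ultimately show ?thesis by (intro exI conjI)
  qed
  fix \<phi> \<psi> assume *: "\<phi> \<in> null_space R T M" "\<psi> \<in> null_space R T M"
    "\<And>b. b \<in> B \<Longrightarrow> evaluation b \<phi> = evaluation b \<psi>"
  have "\<phi>(t := 0) = \<psi>(t := 0)"
    by (rule coordinates_unique[OF assms(6)]) (use * E[of \<phi>] E[of \<psi>] assms(5) in auto)
  then have eq: "\<phi> s = \<psi> s" if "s \<noteq> t" for s using that by (metis fun_upd_apply)
  have "(\<Sum>s\<in>T - {t}. M r s * \<phi> s) = (\<Sum>s\<in>T - {t}. M r s * \<psi> s)"
    by (rule sum.cong) (auto simp: eq)
  then have "\<phi> t = \<psi> t" using * E[of \<phi>] E[of \<psi>] by simp
  with eq show "\<phi> = \<psi>" by (metis ext)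
qed

text \<open>Paired entries vanish simultaneously, so the two eliminations can use the same pivots
  throughout; \<open>B\<close> consists of the columns that never carried a pivot. One set serving
  both systems yields equality of dimensions with no further comparison.\<close>

lemma coordinates_null_space_common:
  assumes "finite T"
    and "\<And>a b a' b'. (a, b) \<in> P \<Longrightarrow> (a', b') \<in> P \<Longrightarrow> (a * a', b * b') \<in> P"
    and "\<And>a b a' b'. (a, b) \<in> P \<Longrightarrow> (a', b') \<in> P \<Longrightarrow> (a - a', b - b') \<in> P"
    and "\<And>a b. (a, b) \<in> P \<Longrightarrow> a = 0 \<longleftrightarrow> b = 0"
    and "\<And>r t. r \<in> R \<Longrightarrow> t \<in> T \<Longrightarrow> (M r t, N r t) \<in> P"
  obtains B where "B \<subseteq> T"
    "coordinates (null_space R T M) B evaluation" "coordinates (null_space R T N) B evaluation"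
proof -
  have "\<exists>B \<subseteq> T. coordinates (null_space R T M) B evaluation \<and>
      coordinates (null_space R T N) B evaluation"
    using assms(1,5)
  proof (induction T arbitrary: R M N rule: finite_psubset_induct)
    case (psubset T)
    show ?case
    proof (cases "\<exists>r\<in>R. \<exists>t\<in>T. M r t \<noteq> 0")
      case True
      then obtain r t where rt: "r \<in> R" "t \<in> T" "M r t \<noteq> 0" by blast
      then have N: "N r t \<noteq> 0" using psubset.prems[OF rt(1,2)] assms(4) by metis
      have "\<exists>B \<subseteq> T - {t}.
          coordinates (null_space (R - {r}) (T - {t}) (eliminate M r t)) B evaluation \<and>
          coordinates (null_space (R - {r}) (T - {t}) (eliminate N r t)) B evaluation"
      proof (rule psubset.IH)
        show "T - {t} \<subset> T" using rt by auto
        show "(eliminate M r t r' s, eliminate N r t r' s) \<in> P" if "r' \<in> R - {r}" "s \<in> T - {t}" for r' s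
          unfolding eliminate_def using that rt by (intro assms(2,3) psubset.prems) auto
      qed
      then obtain B where B: "B \<subseteq> T - {t}"
          "coordinates (null_space (R - {r}) (T - {t}) (eliminate M r t)) B evaluation"
          "coordinates (null_space (R - {r}) (T - {t}) (eliminate N r t)) B evaluation" by blast
      show ?thesis
        using coordinates_eliminate[where M = M, OF psubset.hyps rt(2,1,3) B(1,2)]
          coordinates_eliminate[where M = N, OF psubset.hyps rt(2,1) N B(1,3)] B(1) by blast
    next
      \<comment> \<open>With no pivot left, neither system imposes a condition and every remaining
        column is free.\<close>
      case False
      then have M: "M r t = 0" if "r \<in> R" "t \<in> T" for r t using that by blast
      then have N: "N r t = 0" if "r \<in> R" "t \<in> T" for r t
        using that psubset.prems assms(4) by metis
      have "null_space R T M = {\<phi>. \<forall>t. t \<notin> T \<longrightarrow> \<phi> t = 0}"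
        "null_space R T N = {\<phi>. \<forall>t. t \<notin> T \<longrightarrow> \<phi> t = 0}"
        using M N by (auto simp: null_space_def)
      moreover have "coordinates {\<phi>. \<forall>t. t \<notin> T \<longrightarrow> \<phi> t = 0} T evaluation"
      proof (rule coordinatesI)
        show "\<exists>\<phi>. \<phi> \<in> {\<phi>. \<forall>t. t \<notin> T \<longrightarrow> \<phi> t = 0} \<and> (\<forall>b\<in>T. evaluation b \<phi> = g b)" for g
          by (rule exI[of _ "\<lambda>t. if t \<in> T then g t else 0"]) simp
      qed (simp add: fun_eq_iff, metis)
      ultimately show ?thesis by (intro exI[of _ T]) (simp only: order_refl simp_thms)
    qed
  qed
  with that show ?thesis by blast
qed

text \<open>Take the elements \<open>w b\<close> dual to the first family. If \<open>D\<close> were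
  smaller than \<open>B\<close>, some nontrivial combination of them would be killed by every
  \<open>\<mu> d\<close>, hence be 0 by uniqueness, contradicting its values under
  \<open>\<kappa>\<close>.\<close>

lemma coordinates_card_le:
  fixes W :: "('c \<Rightarrow> real) set" and B :: "'b set"
  assumes "coordinates W B \<kappa>" "coordinates W D \<mu>" "finite B" "finite D"
    and comb: "\<And>c w. (\<And>b. b \<in> B \<Longrightarrow> w b \<in> W) \<Longrightarrow> (\<lambda>t. \<Sum>b\<in>B. c b * w b t) \<in> W"
    and lin_\<kappa>: "\<And>b c w. \<kappa> b (\<lambda>t. \<Sum>b\<in>B. c b * w b t) = (\<Sum>b'\<in>B. c b' * \<kappa> b (w b'))"
    and lin_\<mu>: "\<And>d c w. \<mu> d (\<lambda>t. \<Sum>b\<in>B. c b * w b t) = (\<Sum>b'\<in>B. c b' * \<mu> d (w b'))"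
  shows "card B \<le> card D"
proof -
  have "\<exists>w. w \<in> W \<and> (\<forall>b'\<in>B. \<kappa> b' w = (if b' = b then 1 else 0))" for b
    by (rule coordinates_obtain[OF assms(1), of "\<lambda>b'. if b' = b then 1 else 0"]) blast
  then have "\<forall>b. \<exists>w. w \<in> W \<and> (\<forall>b'\<in>B. \<kappa> b' w = (if b' = b then 1 else 0))" by blast
  then obtain w where "\<forall>b. w b \<in> W \<and> (\<forall>b'\<in>B. \<kappa> b' (w b) = (if b' = b then 1 else 0))"
    by (rule choice[THEN exE])
  then have w: "\<And>b. w b \<in> W" "\<And>b b'. b' \<in> B \<Longrightarrow> \<kappa> b' (w b) = (if b' = b then 1 else 0)" by auto
  have z: "(\<lambda>_. 0) \<in> W" using comb[of w "\<lambda>_. 0"] w by simp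
  have \<mu>z: "\<mu> d (\<lambda>_. 0) = 0" for d using lin_\<mu>[of d "\<lambda>_. 0" w] by simp
  have \<kappa>z: "\<kappa> b (\<lambda>_. 0) = 0" for b using lin_\<kappa>[of b "\<lambda>_. 0" w] by simp
  have "null_space D B (\<lambda>d b. \<mu> d (w b)) \<subseteq> {\<lambda>_. 0}"
  proof
    fix \<psi> assume \<psi>: "\<psi> \<in> null_space D B (\<lambda>d b. \<mu> d (w b))"
    let ?\<phi> = "\<lambda>t. \<Sum>b\<in>B. \<psi> b * w b t"
    have "?\<phi> \<in> W" using comb w by blast
    moreover have "\<mu> d ?\<phi> = 0" if "d \<in> D" for d
      using \<psi> that by (simp add: lin_\<mu> null_space_def mult.commute)
    ultimately have "?\<phi> = (\<lambda>_. 0)"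
      using z by (intro coordinates_unique[OF assms(2)]) (auto simp: \<mu>z)
    then have "\<kappa> b ?\<phi> = 0" for b using \<kappa>z by (simp only:)
    then have sum0: "(\<Sum>b'\<in>B. \<psi> b' * \<kappa> b (w b')) = 0" for b by (simp only: lin_\<kappa>)
    have "\<psi> b = 0" if "b \<in> B" for b
    proof -
      have "(\<Sum>b'\<in>B. \<psi> b' * \<kappa> b (w b')) = (\<Sum>b'\<in>B. if b' = b then \<psi> b else 0)"
        by (rule sum.cong) (use that w(2) in auto)
      then show ?thesis using sum0[of b] that assms(3) by simp
    qed
    then show "\<psi> \<in> {\<lambda>_. 0}" using \<psi> by (auto simp: null_space_def)
  qed
  then show ?thesis using null_space_trivial_card assms(3,4) by blast
qed

section \<open>Generic matrices\<close>

text \<open>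
  Polynomials are represented by lists of terms, a term consisting of a coefficient and of an
  exponent for each variable in \<open>I\<close>.
\<close>

definition eval_terms :: "'i set \<Rightarrow> ('i \<Rightarrow> real) \<Rightarrow> (rat \<times> ('i \<Rightarrow> nat)) list \<Rightarrow> real" where
  "eval_terms I x ps = (\<Sum>(c, m)\<leftarrow>ps. of_rat c * (\<Prod>i\<in>I. x i ^ m i))"

lemma rat_poly_eval_superset:
  assumes "finite A" "Poly_Mapping.keys p \<subseteq> A"
  shows "rat_poly_eval x p =
     (\<Sum>m\<in>A. of_rat (Poly_Mapping.lookup p m) *
        (\<Prod>i\<in>Poly_Mapping.keys m. x i ^ Poly_Mapping.lookup m i))"
  unfolding rat_poly_eval_def
  by (rule sum.mono_neutral_left) (use assms in \<open>auto simp: in_keys_iff\<close>)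

lemma rat_poly_eval_add: "rat_poly_eval x (p + q) = rat_poly_eval x p + rat_poly_eval x q"
proof -
  let ?A = "Poly_Mapping.keys p \<union> Poly_Mapping.keys q"
  have "Poly_Mapping.keys (p + q) \<subseteq> ?A" by (rule Poly_Mapping.keys_add)
  then show ?thesis
    by (simp add: rat_poly_eval_superset[of ?A] lookup_add of_rat_add distrib_right sum.distrib)
qed

lemma rat_poly_eval_zero [simp]: "rat_poly_eval x 0 = 0"
  by (simp add: rat_poly_eval_def)

lemma rat_poly_eval_single:
  "rat_poly_eval x (Poly_Mapping.single m c) =
    of_rat c * (\<Prod>i\<in>Poly_Mapping.keys m. x i ^ Poly_Mapping.lookup m i)"
  by (simp add: rat_poly_eval_superset[of "{m}"])

text \<open>A bridge from term lists, whose variables will be pairs of a row and a vertex, to formal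
  polynomials, whose variables will be matrix positions; \<open>\<sigma>\<close> then applies the
  labelling. The identity holds at all points \<open>y\<close>, so one polynomial can be compared at
  several of them.\<close>

lemma eval_terms_rat_poly:
  fixes ps :: "(rat \<times> ('i \<Rightarrow> nat)) list" and \<sigma> :: "'i \<Rightarrow> 'j"
  assumes "finite I" "inj_on \<sigma> I"
  obtains p where "\<forall>m\<in>Poly_Mapping.keys p. Poly_Mapping.keys m \<subseteq> \<sigma> ` I"
    "\<And>y. rat_poly_eval y p = eval_terms I (y \<circ> \<sigma>) ps"
proof -
  have "\<exists>p. (\<forall>m\<in>Poly_Mapping.keys p. Poly_Mapping.keys m \<subseteq> \<sigma> ` I) \<and>
    (\<forall>y. rat_poly_eval y p = eval_terms I (y \<circ> \<sigma>) ps)"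
  proof (induction ps)
    case Nil
    then show ?case by (intro exI[of _ 0]) (simp add: eval_terms_def)
  next
    case (Cons cm ps)
    then obtain p where p: "\<forall>m\<in>Poly_Mapping.keys p. Poly_Mapping.keys m \<subseteq> \<sigma> ` I"
      "\<And>y. rat_poly_eval y p = eval_terms I (y \<circ> \<sigma>) ps" by blast
    obtain c m where cm: "cm = (c, m)" by force
    \<comment> \<open>Since \<open>\<sigma>\<close> is injective on \<open>I\<close>, no two
      summands share a variable, so the exponents do not add up.\<close>
    define M where "M = (\<Sum>i\<in>I. Poly_Mapping.single (\<sigma> i) (m i))"
    have look: "Poly_Mapping.lookup M j = (\<Sum>i\<in>I. if \<sigma> i = j then m i else 0)" for j
      unfolding M_def by (simp add: lookup_sum lookup_single when_def)
    have lookI: "Poly_Mapping.lookup M (\<sigma> i) = m i" if "i \<in> I" for i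
    proof -
      have "(\<Sum>k\<in>I. if \<sigma> k = \<sigma> i then m k else 0) = (\<Sum>k\<in>I. if k = i then m k else 0)"
        by (rule sum.cong) (use that assms in \<open>auto dest: inj_onD\<close>)
      then show ?thesis using that assms by (simp add: look)
    qed
    have keys: "Poly_Mapping.keys M \<subseteq> \<sigma> ` I"
    proof
      fix j assume "j \<in> Poly_Mapping.keys M"
      then have "(\<Sum>i\<in>I. if \<sigma> i = j then m i else 0) \<noteq> 0" by (simp add: in_keys_iff look)
      then obtain i where "i \<in> I" "(if \<sigma> i = j then m i else 0) \<noteq> 0" by (rule sum.not_neutral_contains_not_neutral)
      then show "j \<in> \<sigma> ` I" by (auto split: if_splits)
    qed
    have prod: "(\<Prod>j\<in>Poly_Mapping.keys M. y j ^ Poly_Mapping.lookup M j) = (\<Prod>i\<in>I. y (\<sigma> i) ^ m i)"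
      for y :: "'j \<Rightarrow> real"
    proof -
      have "(\<Prod>j\<in>Poly_Mapping.keys M. y j ^ Poly_Mapping.lookup M j) =
          (\<Prod>j\<in>\<sigma> ` I. y j ^ Poly_Mapping.lookup M j)"
        by (rule prod.mono_neutral_left) (use assms keys in \<open>auto simp: in_keys_iff\<close>)
      then show ?thesis using assms by (simp add: prod.reindex lookI)
    qed
    have "Poly_Mapping.keys (Poly_Mapping.single M c + p) \<subseteq> insert M (Poly_Mapping.keys p)"
      using Poly_Mapping.keys_add[of "Poly_Mapping.single M c" p] by (auto split: if_splits)
    then show ?case
      using p keys
      by (intro exI[of _ "Poly_Mapping.single M c + p"] conjI)
        (blast, simp add: rat_poly_eval_add rat_poly_eval_single prod cm eval_terms_def)
  qed
  with that show ?thesis by blast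
qed

text \<open>Vanishing at an algebraically independent point makes the formal polynomial zero, hence
  it vanishes everywhere. The arbitrary point \<open>x\<close> is carried over to the variables in
  \<open>J\<close> by an inverse of \<open>\<sigma>\<close>.\<close>

lemma eval_terms_alg_independent:
  assumes "finite I" "inj_on \<sigma> I" "\<sigma> ` I \<subseteq> J" "alg_independent_over_rat J y"
    and "eval_terms I (y \<circ> \<sigma>) ps = 0"
  shows "eval_terms I x ps = 0"
proof -
  obtain p where p: "\<forall>m\<in>Poly_Mapping.keys p. Poly_Mapping.keys m \<subseteq> \<sigma> ` I"
    "\<And>y. rat_poly_eval y p = eval_terms I (y \<circ> \<sigma>) ps"
    using eval_terms_rat_poly[OF assms(1,2), where ps = ps] by blast
  have "p = 0" using assms(3-5) p unfolding alg_independent_over_rat_def by (metis order_trans)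
  then have "eval_terms I ((x \<circ> inv_into I \<sigma>) \<circ> \<sigma>) ps = 0" using p(2) rat_poly_eval_zero by metis
  also have "eval_terms I ((x \<circ> inv_into I \<sigma>) \<circ> \<sigma>) ps = eval_terms I x ps"
    unfolding eval_terms_def using assms(2)
    by (intro arg_cong[where f = sum_list] map_cong refl) (auto intro!: prod.cong)
  finally show ?thesis .
qed

text \<open>The values of one rational polynomial at two points. This is the relation
  \<open>P\<close> fed to the elimination lemmas: it is closed under ring operations, and genericity
  of a point controls which members vanish there.\<close>

definition poly_pairs :: "'i set \<Rightarrow> ('i \<Rightarrow> real) \<Rightarrow> ('i \<Rightarrow> real) \<Rightarrow> (real \<times> real) set" where
  "poly_pairs I x y = range (\<lambda>ps. (eval_terms I x ps, eval_terms I y ps))"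

lemma poly_pairs_mult:
  assumes "(a, b) \<in> poly_pairs I x y" "(a', b') \<in> poly_pairs I x y"
  shows "(a * a', b * b') \<in> poly_pairs I x y"
proof -
  define mul :: "(rat \<times> ('a \<Rightarrow> nat)) list \<Rightarrow> (rat \<times> ('a \<Rightarrow> nat)) list \<Rightarrow> (rat \<times> ('a \<Rightarrow> nat)) list"
    where "mul ps qs = concat (map (\<lambda>(c, m). map (\<lambda>(c', m'). (c * c', \<lambda>i. m i + m' i)) qs) ps)" for ps qs
  have single: "eval_terms I z (map (\<lambda>(c', m'). (c * c', \<lambda>i. m i + m' i)) qs) =
      of_rat c * (\<Prod>i\<in>I. z i ^ m i) * eval_terms I z qs" for z c m qs
    by (induction qs) (auto simp: eval_terms_def of_rat_mult power_add prod.distrib algebra_simps)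
  have app: "eval_terms I z (ps @ qs) = eval_terms I z ps + eval_terms I z qs" for z ps qs
    by (simp add: eval_terms_def)
  have "eval_terms I z (mul ps qs) = eval_terms I z ps * eval_terms I z qs" for z ps qs
  proof (induction ps)
    case (Cons cm ps)
    then show ?case
      by (cases cm) (simp add: mul_def app single, simp add: eval_terms_def algebra_simps)
  qed (simp add: mul_def eval_terms_def)
  then show ?thesis using assms unfolding poly_pairs_def by (auto simp: image_iff) metis
qed

lemma poly_pairs_diff:
  assumes "(a, b) \<in> poly_pairs I x y" "(a', b') \<in> poly_pairs I x y"
  shows "(a - a', b - b') \<in> poly_pairs I x y"
proof -
  have "eval_terms I z (ps @ map (\<lambda>(c, m). (- c, m)) qs) = eval_terms I z ps - eval_terms I z qs"
    for z ps qs
    by (induction qs) (auto simp: eval_terms_def of_rat_minus)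
  then show ?thesis using assms unfolding poly_pairs_def by (auto simp: image_iff) metis
qed

lemma poly_pairs_zero: "(0, 0) \<in> poly_pairs I x y"
  unfolding poly_pairs_def by (rule range_eqI[of _ _ "[]"]) (simp add: eval_terms_def)

lemma poly_pairs_uminus: "(a, b) \<in> poly_pairs I x y \<Longrightarrow> (- a, - b) \<in> poly_pairs I x y"
  using poly_pairs_diff[OF poly_pairs_zero] by fastforce

lemma poly_pairs_add:
  assumes "(a, b) \<in> poly_pairs I x y" "(a', b') \<in> poly_pairs I x y"
  shows "(a + a', b + b') \<in> poly_pairs I x y"
  using poly_pairs_diff[OF assms(1) poly_pairs_uminus[OF assms(2)]] by simp

lemma poly_pairs_sum:
  assumes "\<And>a. a \<in> A \<Longrightarrow> (f a, g a) \<in> poly_pairs I x y"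
  shows "(sum f A, sum g A) \<in> poly_pairs I x y"
  using assms
  by (induction A rule: infinite_finite_induct) (auto intro: poly_pairs_add poly_pairs_zero)

lemma poly_pairs_var:
  assumes "finite I" "i \<in> I"
  shows "(x i, y i) \<in> poly_pairs I x y"
proof -
  have "eval_terms I z [(1, \<lambda>k. if k = i then 1 else 0)] = z i" for z
  proof -
    have "eval_terms I z [(1, \<lambda>k. if k = i then 1 else 0)] = (\<Prod>k\<in>I. if k = i then z k else 1)"
      unfolding eval_terms_def by (auto intro!: prod.cong)
    then show ?thesis using assms by simp
  qed
  then show ?thesis unfolding poly_pairs_def
    by (intro range_eqI[of _ _ "[(1, \<lambda>k. if k = i then 1 else 0)]"]) simp
qed

text \<open>The pairs \<open>(j, v)\<close> land on distinct entries of the matrix because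
  \<open>l\<close> is injective on \<open>V\<close>, and inside it because \<open>m \<le> n\<close>;
  the values at these entries are therefore algebraically independent.\<close>

lemma generic_matrix_poly_pairs:
  assumes "generic_matrix n \<alpha>" "finite V" "inj_on l V" "l ` V \<subseteq> {1..n}" "m \<le> n"
    and "(a, b) \<in> poly_pairs ({1..m} \<times> V) (\<lambda>(j, v). \<alpha> j (l v)) y" "a = 0"
  shows "b = 0"
proof -
  let ?I = "{1..m} \<times> V" and ?\<sigma> = "\<lambda>(j, v). (j, l v)"
  obtain ps where ps: "a = eval_terms ?I (\<lambda>(j, v). \<alpha> j (l v)) ps" "b = eval_terms ?I y ps"
    using assms(6) by (auto simp: poly_pairs_def)
  have eq: "(\<lambda>(j, v). \<alpha> j (l v)) = (\<lambda>(i, j). \<alpha> i j) \<circ> ?\<sigma>" by auto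
  show ?thesis unfolding ps
  proof (rule eval_terms_alg_independent[where \<sigma> = ?\<sigma> and J = "{1..n} \<times> {1..n}"])
    show "alg_independent_over_rat ({1..n} \<times> {1..n}) (\<lambda>(i, j). \<alpha> i j)"
      using assms(1) by (simp add: generic_matrix_def)
    show "eval_terms ?I ((\<lambda>(i, j). \<alpha> i j) \<circ> ?\<sigma>) ps = 0" using ps assms(7) eq by simp
  qed (use assms in \<open>auto simp: inj_on_def\<close>)
qed

text \<open>Triviality of the kernel passes from one real matrix to a generic one of the same shape,
  so a single example suffices.\<close>

lemma generic_matrix_trivial_kernel:
  assumes "generic_matrix n \<alpha>" "finite V" "inj_on l V" "l ` V \<subseteq> {1..n}" "card V \<le> m" "m \<le> n"
    and "\<And>j. j \<in> {1..m} \<Longrightarrow> (\<Sum>v\<in>V. \<alpha> j (l v) * \<phi> v) = 0" "v \<in> V"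
  shows "\<phi> v = 0"
proof -
  obtain h where h: "inj_on h V" "h ` V \<subseteq> {1..m}"
    using inj_on_iff_card_le[of V "{1..m}"] assms by auto
  \<comment> \<open>A 1 in row \<open>h v\<close> for each column \<open>v\<close>, in distinct
    rows: a partial permutation matrix, whose kernel is visibly trivial.\<close>
  define N :: "nat \<Rightarrow> 'a \<Rightarrow> real" where "N j v = (if j = h v then 1 else 0)" for j v
  let ?P = "poly_pairs ({1..m} \<times> V) (\<lambda>(j, v). \<alpha> j (l v)) (\<lambda>(j, v). N j v)"
  have "null_space {1..m} V (\<lambda>j v. \<alpha> j (l v)) \<subseteq> {\<lambda>_. 0}"
  proof (rule null_space_trivial_specialize[where P = ?P and N = N])
    show "b = 0" if "(0, b) \<in> ?P" for b
      using generic_matrix_poly_pairs[OF assms(1-4,6) that] by simp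
    show "(\<alpha> j (l v), N j v) \<in> ?P" if "j \<in> {1..m}" "v \<in> V" for j v
      using poly_pairs_var[of "{1..m} \<times> V" "(j, v)" "\<lambda>(j, v). \<alpha> j (l v)" "\<lambda>(j, v). N j v"] that assms
      by auto
    show "null_space {1..m} V N \<subseteq> {\<lambda>_. 0}"
    proof
      fix \<psi> assume \<psi>: "\<psi> \<in> null_space {1..m} V N"
      have "\<psi> v = 0" if "v \<in> V" for v
      proof -
        have "(\<Sum>u\<in>V. N (h v) u * \<psi> u) = 0" using \<psi> that h by (auto simp: null_space_def)
        also have "(\<Sum>u\<in>V. N (h v) u * \<psi> u) = (\<Sum>u\<in>V. if u = v then \<psi> v else 0)"
          by (rule sum.cong) (use that h in \<open>auto simp: N_def dest: inj_onD\<close>)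
        finally show ?thesis using that assms by simp
      qed
      then show "\<psi> \<in> {\<lambda>_. 0}" using \<psi> by (auto simp: null_space_def)
    qed
  qed (use assms poly_pairs_mult poly_pairs_diff in auto)
  \<comment> \<open>The vector is cut off outside \<open>V\<close>, as membership in
    \<open>null_space\<close> demands.\<close>
  moreover have "(\<Sum>u\<in>V. \<alpha> j (l u) * (if u \<in> V then \<phi> u else 0)) = 0" if "j \<in> {1..m}" for j
    using assms(7)[OF that] by (simp cong: sum.cong)
  then have "(\<lambda>u. if u \<in> V then \<phi> u else 0) \<in> null_space {1..m} V (\<lambda>j v. \<alpha> j (l v))"
    by (simp add: null_space_def)
  ultimately have "(\<lambda>u. if u \<in> V then \<phi> u else 0) = (\<lambda>_. 0)" by auto
  then show ?thesis using assms(8) by (auto dest: fun_cong[of _ _ v])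
qed

section \<open>Generic cycles of a complex\<close>

text \<open>The sign of moving \<open>v\<close> into its place when it is put in front of the
  \<open>r\<close>-ordered product over \<open>U\<close>. The rank \<open>r\<close> is a parameter
  since the shift and the argument for joins use different vertex orders.\<close>

definition ord_sign :: "('a \<Rightarrow> nat) \<Rightarrow> 'a \<Rightarrow> 'a set \<Rightarrow> real" where
  "ord_sign r v U = (-1) ^ card {u \<in> U. r u < r v}"

text \<open>The degree \<open>d\<close> counts vertices, so that the empty face has degree 0, where
  no boundary condition applies. Terms with \<open>insert v U\<close> outside \<open>K\<close> drop
  out by the support condition, so the sum may run over all vertices.\<close>

definition cycles ::
  "('a \<Rightarrow> nat) \<Rightarrow> (nat \<Rightarrow> 'a \<Rightarrow> real) \<Rightarrow> nat \<Rightarrow> 'a set set \<Rightarrow> nat \<Rightarrow> ('a set \<Rightarrow> real) set" where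
  "cycles r a i K d =
     {\<phi>. (\<forall>T. T \<notin> K \<or> card T \<noteq> d \<longrightarrow> \<phi> T = 0) \<and>
        (\<forall>j\<in>{1..i}. \<forall>U\<in>K. card U + 1 = d \<longrightarrow>
           (\<Sum>v\<in>complex_vertices K - U. ord_sign r v U * a j v * \<phi> (insert v U)) = 0)}"

lemma finite_complexD:
  assumes "finite_complex K"
  shows "finite K" "T \<in> K \<Longrightarrow> finite T" "{} \<in> K" "T \<in> K \<Longrightarrow> S \<subseteq> T \<Longrightarrow> S \<in> K"
    "finite (complex_vertices K)" "T \<in> K \<Longrightarrow> T \<subseteq> complex_vertices K"
  using assms unfolding finite_complex_def complex_vertices_def by blast+

lemma cycles_outside:
  assumes "\<phi> \<in> cycles r a i K d" "T \<notin> K \<or> card T \<noteq> d"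
  shows "\<phi> T = 0"
  using assms unfolding cycles_def by blast

lemma cycles_boundary:
  assumes "\<phi> \<in> cycles r a i K d" "j \<in> {1..i}" "U \<in> K" "card U + 1 = d"
  shows "(\<Sum>v\<in>complex_vertices K - U. ord_sign r v U * a j v * \<phi> (insert v U)) = 0"
  using assms unfolding cycles_def by blast

lemma cyclesI:
  assumes "\<And>T. T \<notin> K \<or> card T \<noteq> d \<Longrightarrow> \<phi> T = 0"
    and "\<And>j U. j \<in> {1..i} \<Longrightarrow> U \<in> K \<Longrightarrow> card U + 1 = d \<Longrightarrow>
      (\<Sum>v\<in>complex_vertices K - U. ord_sign r v U * a j v * \<phi> (insert v U)) = 0"
  shows "\<phi> \<in> cycles r a i K d"
  using assms unfolding cycles_def by blast

lemma cycles_sum: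
  assumes "\<And>b. b \<in> A \<Longrightarrow> w b \<in> cycles r a i K d"
  shows "(\<lambda>T. \<Sum>b\<in>A. c b * w b T) \<in> cycles r a i K d"
proof (rule cyclesI)
  show "(\<Sum>b\<in>A. c b * w b T) = 0" if "T \<notin> K \<or> card T \<noteq> d" for T
    using cycles_outside[OF assms that] by simp
  fix j U assume U: "j \<in> {1..i}" "U \<in> K" "card U + 1 = d"
  let ?V = "complex_vertices K - U"
  have "(\<Sum>v\<in>?V. ord_sign r v U * a j v * (\<Sum>b\<in>A. c b * w b (insert v U))) =
      (\<Sum>b\<in>A. c b * (\<Sum>v\<in>?V. ord_sign r v U * a j v * w b (insert v U)))"
    unfolding sum_distrib_left by (subst sum.swap) (simp add: mult_ac)
  also have "\<dots> = 0" using cycles_boundary[OF assms U] by (simp cong: sum.cong)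
  finally show "(\<Sum>v\<in>?V. ord_sign r v U * a j v * (\<Sum>b\<in>A. c b * w b (insert v U))) = 0" .
qed

text \<open>At most one \<open>v\<close> contributes to an entry. Writing the entry as a sum makes
  it visibly a polynomial in the weights with coefficients 1 or -1, which is what the comparison of
  two choices of weights works with.\<close>

lemma cycles_eq_null_space:
  assumes "finite_complex K"
  shows "cycles r a i K d =
    null_space ({1..i} \<times> {U \<in> K. card U + 1 = d}) {T \<in> K. card T = d}
      (\<lambda>(j, U) T. \<Sum>v\<in>complex_vertices K - U. if insert v U = T then ord_sign r v U * a j v else 0)"
    (is "_ = null_space _ ?T ?M")
proof -
  note K = finite_complexD[OF assms]
  have row: "(\<Sum>T\<in>?T. ?M (j, U) T * \<phi> T) =
      (\<Sum>v\<in>complex_vertices K - U. ord_sign r v U * a j v * \<phi> (insert v U))"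
    if "\<forall>T. T \<notin> K \<or> card T \<noteq> d \<longrightarrow> \<phi> T = 0" for j U \<phi>
  proof -
    let ?V = "complex_vertices K - U" and ?c = "\<lambda>v. ord_sign r v U * a j v"
    have "(\<Sum>T\<in>?T. ?M (j, U) T * \<phi> T) =
        (\<Sum>T\<in>?T. \<Sum>v\<in>?V. if insert v U = T then ?c v * \<phi> (insert v U) else 0)"
      unfolding prod.case sum_distrib_right by (intro sum.cong refl) auto
    also have "\<dots> = (\<Sum>v\<in>?V. \<Sum>T\<in>?T. if insert v U = T then ?c v * \<phi> (insert v U) else 0)"
      by (rule sum.swap)
    also have "\<dots> = (\<Sum>v\<in>?V. ?c v * \<phi> (insert v U))"
      using K(1) that by (intro sum.cong refl) auto
    finally show ?thesis .
  qed
  show ?thesis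
  proof (rule set_eqI)
    fix \<phi> :: "'a set \<Rightarrow> real"
    show "\<phi> \<in> cycles r a i K d \<longleftrightarrow> \<phi> \<in> null_space ({1..i} \<times> {U \<in> K. card U + 1 = d}) ?T ?M"
    proof (cases "\<forall>T. T \<notin> K \<or> card T \<noteq> d \<longrightarrow> \<phi> T = 0")
      case True
      then show ?thesis
        using row[OF True] unfolding cycles_def null_space_def by auto
    next
      case False
      then show ?thesis unfolding cycles_def null_space_def by auto
    qed
  qed
qed

text \<open>For a fixed order \<open>r\<close> both systems have the same polynomials as entries,
  evaluated at two points that are each algebraically independent; so whatever elimination produces
  vanishes for both or for neither.\<close>

lemma cycles_generic_common:
  assumes "finite_complex K" "i \<le> n\<^sub>1" "i \<le> n\<^sub>2"
    and "generic_matrix n\<^sub>1 \<alpha>" "inj_on l\<^sub>1 (complex_vertices K)" "l\<^sub>1 ` complex_vertices K \<subseteq> {1..n\<^sub>1}"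
    and "generic_matrix n\<^sub>2 \<beta>" "inj_on l\<^sub>2 (complex_vertices K)" "l\<^sub>2 ` complex_vertices K \<subseteq> {1..n\<^sub>2}"
  obtains B where "B \<subseteq> {T \<in> K. card T = d}"
    "coordinates (cycles r (\<lambda>j v. \<alpha> j (l\<^sub>1 v)) i K d) B evaluation"
    "coordinates (cycles r (\<lambda>j v. \<beta> j (l\<^sub>2 v)) i K d) B evaluation"
proof -
  note K = finite_complexD[OF assms(1)]
  let ?V = "complex_vertices K"
  let ?x = "\<lambda>(j, v). \<alpha> j (l\<^sub>1 v)" and ?y = "\<lambda>(j, v). \<beta> j (l\<^sub>2 v)"
  let ?I = "{1..i} \<times> ?V"
  let ?P = "poly_pairs ?I ?x ?y"
  let ?M = "\<lambda>a (j, U) T. \<Sum>v\<in>?V - U. if insert v U = T then ord_sign r v U * a j v else 0"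
  have fin: "finite {T \<in> K. card T = d}" using K(1) by simp
  have zero: "a = 0 \<longleftrightarrow> b = 0" if "(a, b) \<in> ?P" for a b
  proof -
    \<comment> \<open>Reading the pair backwards exchanges the roles of the two generic
      points.\<close>
    have "(b, a) \<in> poly_pairs ?I ?y ?x" using that by (auto simp: poly_pairs_def)
    then show ?thesis
      using generic_matrix_poly_pairs[OF assms(4) K(5) assms(5,6,2) that]
        generic_matrix_poly_pairs[OF assms(7) K(5) assms(8,9,3)] by blast
  qed
  have entry: "(?M (\<lambda>j v. \<alpha> j (l\<^sub>1 v)) q T, ?M (\<lambda>j v. \<beta> j (l\<^sub>2 v)) q T) \<in> ?P"
    if q: "q \<in> {1..i} \<times> {U \<in> K. card U + 1 = d}" for q T
  proof -
    obtain j U where q': "q = (j, U)" by force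
    show ?thesis unfolding q' prod.case
    proof (rule poly_pairs_sum)
      fix v assume v: "v \<in> ?V - U"
      have "(?x (j, v), ?y (j, v)) \<in> ?P" using K(5) q q' v by (intro poly_pairs_var) auto
      then have "(ord_sign r v U * \<alpha> j (l\<^sub>1 v), ord_sign r v U * \<beta> j (l\<^sub>2 v)) \<in> ?P"
        using poly_pairs_uminus
        by (cases "even (card {u \<in> U. r u < r v})") (auto simp: ord_sign_def)
      then show "(if insert v U = T then ord_sign r v U * \<alpha> j (l\<^sub>1 v) else 0,
          if insert v U = T then ord_sign r v U * \<beta> j (l\<^sub>2 v) else 0) \<in> ?P"
        using poly_pairs_zero by auto
    qed
  qed
  show ?thesis
    by (rule coordinates_null_space_common[OF fin poly_pairs_mult poly_pairs_diff zero entry])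
      (use that in \<open>auto simp: cycles_eq_null_space[OF assms(1)]\<close>)
qed

section \<open>Change of the vertex order\<close>

definition inversion_sign :: "('a \<Rightarrow> nat) \<Rightarrow> ('a \<Rightarrow> nat) \<Rightarrow> 'a set \<Rightarrow> real" where
  "inversion_sign r r' T = (-1) ^ card {(u, w). u \<in> T \<and> w \<in> T \<and> r u < r w \<and> r' w < r' u}"

lemma inversion_sign_square [simp]: "inversion_sign r r' T * inversion_sign r r' T = 1"
  by (simp add: inversion_sign_def flip: power_add mult_2)

text \<open>The inversions of \<open>insert v U\<close> that involve \<open>v\<close> come from the
  \<open>u\<close> on which the two orders disagree about preceding \<open>v\<close>. These form the
  symmetric difference of the two sets counted by \<open>ord_sign\<close>, which has the parity of
  the sum of their sizes.\<close>

lemma inversion_sign_insert: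
  assumes "finite U" "v \<notin> U" "inj_on r (insert v U)" "inj_on r' (insert v U)"
  shows "ord_sign r' v U * inversion_sign r r' (insert v U) = inversion_sign r r' U * ord_sign r v U"
proof -
  let ?X = "{u \<in> U. r u < r v}" and ?Y = "{u \<in> U. r' u < r' v}"
  let ?Inv = "\<lambda>T. {(u, w). u \<in> T \<and> w \<in> T \<and> r u < r w \<and> r' w < r' u}"
  have ne: "r u \<noteq> r v" "r' u \<noteq> r' v" if "u \<in> U" for u
    using that assms(2) inj_onD[OF assms(3), of u v] inj_onD[OF assms(4), of u v] by auto
  have XY: "?X - ?Y = {u \<in> U. r u < r v \<and> r' v < r' u}" "?Y - ?X = {u \<in> U. r v < r u \<and> r' u < r' v}"
    using ne by (auto simp: not_less nat_less_le)
  have eq: "?Inv (insert v U) = ?Inv U \<union> (\<lambda>u. (u, v)) ` (?X - ?Y) \<union> Pair v ` (?Y - ?X)"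
    unfolding XY by auto
  have "finite (?Inv U)" by (rule finite_subset[of _ "U \<times> U"]) (use assms in auto)
  then have "card (?Inv (insert v U)) = card (?Inv U) + card (?X - ?Y) + card (?Y - ?X)"
    unfolding eq using assms
    by (subst card_Un_disjoint, auto)+ (simp add: card_image inj_on_def)
  moreover have "card ?X = card (?X \<inter> ?Y) + card (?X - ?Y)" "card ?Y = card (?X \<inter> ?Y) + card (?Y - ?X)"
    using assms by (auto simp: card_Int_Diff[of ?X ?Y] card_Int_Diff[of ?Y ?X] Int_commute)
  ultimately have "card ?Y + card (?Inv (insert v U)) = card (?Inv U) + card ?X + 2 * card (?Y - ?X)"
    by simp
  then show ?thesis
    unfolding ord_sign_def inversion_sign_def by (simp flip: power_add) (simp add: power_add power_mult)
qed

text \<open>Rescaling each face by its inversion sign turns one boundary operator into the other, up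
  to a sign depending only on \<open>U\<close>, which does not affect vanishing.\<close>

lemma inversion_sign_cycles:
  assumes "finite_complex K" "inj_on r (complex_vertices K)" "inj_on r' (complex_vertices K)"
  shows "(\<lambda>T. inversion_sign r r' T * \<phi> T) \<in> cycles r' a i K d \<longleftrightarrow> \<phi> \<in> cycles r a i K d"
proof -
  note K = finite_complexD[OF assms(1)]
  let ?s = "inversion_sign r r'" and ?V = "complex_vertices K"
  have nz: "?s T \<noteq> 0" for T by (simp add: inversion_sign_def)
  have row: "(\<Sum>v\<in>?V - U. ord_sign r' v U * a j v * (?s (insert v U) * \<phi> (insert v U))) =
      ?s U * (\<Sum>v\<in>?V - U. ord_sign r v U * a j v * \<phi> (insert v U))" if "U \<in> K" for U j
    unfolding sum_distrib_left
  proof (rule sum.cong)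
    fix v assume v: "v \<in> ?V - U"
    have "insert v U \<subseteq> ?V" using v K(6)[OF that] by auto
    then have "ord_sign r' v U * ?s (insert v U) = ?s U * ord_sign r v U"
      using v K(2)[OF that] inj_on_subset[OF assms(2)] inj_on_subset[OF assms(3)]
      by (intro inversion_sign_insert) blast+
    then show "ord_sign r' v U * a j v * (?s (insert v U) * \<phi> (insert v U)) =
        ?s U * (ord_sign r v U * a j v * \<phi> (insert v U))"
      by algebra
  qed simp
  show ?thesis unfolding cycles_def using row nz by simp
qed

text \<open>The isomorphism is diagonal with entries 1 and -1, so the same faces serve as
  coordinates.\<close>

lemma coordinates_cycles_order:
  assumes "finite_complex K" "inj_on r (complex_vertices K)" "inj_on r' (complex_vertices K)"
    and "coordinates (cycles r a i K d) B evaluation"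
  shows "coordinates (cycles r' a i K d) B evaluation"
proof (rule coordinatesI)
  let ?s = "inversion_sign r r'"
  note iff = inversion_sign_cycles[OF assms(1-3)]
  fix g
  obtain \<phi> where \<phi>: "\<phi> \<in> cycles r a i K d" "\<And>b. b \<in> B \<Longrightarrow> evaluation b \<phi> = ?s b * g b"
    using coordinates_obtain[OF assms(4), of "\<lambda>b. ?s b * g b"] by blast
  have "evaluation b (\<lambda>T. ?s T * \<phi> T) = g b" if "b \<in> B" for b
    using \<phi>(2)[OF that] inversion_sign_square[of r r' b] by simp
  then show "\<exists>\<phi>. \<phi> \<in> cycles r' a i K d \<and> (\<forall>b\<in>B. evaluation b \<phi> = g b)"
    using \<phi>(1) iff by blast
next
  let ?s = "inversion_sign r r'"
  note iff = inversion_sign_cycles[OF assms(1-3)]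
  have inverse: "(\<lambda>T. ?s T * \<phi> T) \<in> cycles r a i K d" if "\<phi> \<in> cycles r' a i K d" for \<phi>
    using that iff[of "\<lambda>T. ?s T * \<phi> T"] by (simp flip: mult.assoc)
  fix \<phi> \<psi> assume *: "\<phi> \<in> cycles r' a i K d" "\<psi> \<in> cycles r' a i K d"
    "\<And>b. b \<in> B \<Longrightarrow> evaluation b \<phi> = evaluation b \<psi>"
  have "(\<lambda>T. ?s T * \<phi> T) = (\<lambda>T. ?s T * \<psi> T)"
    by (rule coordinates_unique[OF assms(4) inverse inverse]) (use * in auto)
  then have "?s T * (?s T * \<phi> T) = ?s T * (?s T * \<psi> T)" for T by (metis (no_types))
  then show "\<phi> = \<psi>" by (simp add: fun_eq_iff flip: mult.assoc)
qed

subsection \<open>Joins\<close>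

context
  fixes K L :: "'a set set"
  assumes K: "finite_complex K" and L: "finite_complex L"
    and disj: "complex_vertices K \<inter> complex_vertices L = {}"
begin

text \<open>Disjointness of the vertex sets makes the decomposition of a face unique, so it can be
  read off by intersecting.\<close>

lemma in_complex_join_iff:
  "T \<in> complex_join K L \<longleftrightarrow>
     T \<inter> complex_vertices K \<in> K \<and> T \<inter> complex_vertices L \<in> L \<and> T \<subseteq> complex_vertices K \<union> complex_vertices L"
proof
  assume "T \<in> complex_join K L"
  then obtain A B where AB: "T = A \<union> B" "A \<in> K" "B \<in> L" by (auto simp: complex_join_def)
  moreover have "A \<subseteq> complex_vertices K" "B \<subseteq> complex_vertices L"
    using AB finite_complexD(6)[OF K] finite_complexD(6)[OF L] by auto
  moreover have "T \<inter> complex_vertices K = A" "T \<inter> complex_vertices L = B"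
    using calculation disj by auto
  ultimately show "T \<inter> complex_vertices K \<in> K \<and> T \<inter> complex_vertices L \<in> L \<and>
      T \<subseteq> complex_vertices K \<union> complex_vertices L" by auto
next
  assume *: "T \<inter> complex_vertices K \<in> K \<and> T \<inter> complex_vertices L \<in> L \<and>
      T \<subseteq> complex_vertices K \<union> complex_vertices L"
  then have "T = (T \<inter> complex_vertices K) \<union> (T \<inter> complex_vertices L)" by auto
  with * show "T \<in> complex_join K L" unfolding complex_join_def by blast
qed

lemma Un_in_complex_join: "S \<in> K \<Longrightarrow> T \<in> L \<Longrightarrow> S \<union> T \<in> complex_join K L"
  by (auto simp: complex_join_def)

lemma complex_vertices_join:
  "complex_vertices (complex_join K L) = complex_vertices K \<union> complex_vertices L"
proof
  show "complex_vertices (complex_join K L) \<subseteq> complex_vertices K \<union> complex_vertices L"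
    by (auto simp: complex_vertices_def complex_join_def)
  have "S \<in> complex_join K L" if "S \<in> K \<or> S \<in> L" for S
    using that Un_in_complex_join[of S "{}"] Un_in_complex_join[of "{}" S]
      finite_complexD(3)[OF K] finite_complexD(3)[OF L] by auto
  then show "complex_vertices K \<union> complex_vertices L \<subseteq> complex_vertices (complex_join K L)"
    unfolding complex_vertices_def by blast
qed

lemma finite_complex_join: "finite_complex (complex_join K L)"
proof -
  have "complex_join K L = (\<lambda>(S, T). S \<union> T) ` (K \<times> L)" by (auto simp: complex_join_def)
  then have "finite (complex_join K L)"
    using finite_complexD(1)[OF K] finite_complexD(1)[OF L] by simp
  moreover have "T \<in> complex_join K L" if "S \<in> complex_join K L" "T \<subseteq> S" for S T
  proof -
    have "T \<inter> complex_vertices K \<subseteq> S \<inter> complex_vertices K" "T \<inter> complex_vertices L \<subseteq> S \<inter> complex_vertices L"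
      using that by auto
    then show ?thesis
      using that finite_complexD(4)[OF K] finite_complexD(4)[OF L]
      unfolding in_complex_join_iff by blast
  qed
  moreover have "{} \<in> complex_join K L"
    using Un_in_complex_join[of "{}" "{}"] finite_complexD(3)[OF K] finite_complexD(3)[OF L] by simp
  moreover have "finite S" if "S \<in> complex_join K L" for S
    using that finite_complexD(2)[OF K] finite_complexD(2)[OF L] by (auto simp: complex_join_def)
  ultimately show ?thesis unfolding finite_complex_def by blast
qed

lemma complex_join_trace:
  assumes "A \<subseteq> complex_vertices K" "B \<subseteq> complex_vertices L"
  shows "(A \<union> B) \<inter> complex_vertices K = A" "(A \<union> B) \<inter> complex_vertices L = B"
  using assms disj by auto

lemma Un_in_complex_join_iff:
  assumes "A \<subseteq> complex_vertices K" "B \<subseteq> complex_vertices L"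
  shows "A \<union> B \<in> complex_join K L \<longleftrightarrow> A \<in> K \<and> B \<in> L"
  using assms unfolding in_complex_join_iff complex_join_trace[OF assms] by auto

lemma card_image_join:
  assumes "A \<subseteq> K" "B \<subseteq> L"
  shows "card ((\<lambda>(S, T). S \<union> T) ` (A \<times> B)) = card A * card B"
proof -
  have "inj_on (\<lambda>(S, T). S \<union> T) (A \<times> B)"
  proof (rule inj_onI, clarify)
    fix S T S' T' assume *: "S \<in> A" "T \<in> B" "S' \<in> A" "T' \<in> B" "S \<union> T = S' \<union> T'"
    have sub: "S \<subseteq> complex_vertices K" "T \<subseteq> complex_vertices L"
      "S' \<subseteq> complex_vertices K" "T' \<subseteq> complex_vertices L"
      using * assms by (auto intro!: finite_complexD(6)[OF K] finite_complexD(6)[OF L] del: subsetI)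
    show "S = S' \<and> T = T'"
      using complex_join_trace[OF sub(1,2)] complex_join_trace[OF sub(3,4)] *(5) by simp
  qed
  then show ?thesis by (simp add: card_image card_cartesian_product)
qed

lemma card_complex_join:
  assumes "T \<in> complex_join K L"
  shows "card T = card (T \<inter> complex_vertices K) + card (T \<inter> complex_vertices L)"
proof -
  have T: "T = (T \<inter> complex_vertices K) \<union> (T \<inter> complex_vertices L)"
    using assms unfolding in_complex_join_iff by auto
  have "finite T" using finite_complexD(2)[OF finite_complex_join] assms .
  then show ?thesis by (subst T, subst card_Un_disjoint) (use disj in auto)
qed

section \<open>Top-degree chains of a join, with the vertices of \<open>K\<close> placed before
  those of \<open>L\<close>\<close>

context
  fixes r :: "'a \<Rightarrow> nat" and d\<^sub>1 d\<^sub>2 :: nat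
  assumes order: "\<And>u v. u \<in> complex_vertices K \<Longrightarrow> v \<in> complex_vertices L \<Longrightarrow> r u < r v"
    and top: "\<And>T. T \<in> K \<Longrightarrow> card T \<le> d\<^sub>1" "\<And>T. T \<in> L \<Longrightarrow> card T \<le> d\<^sub>2"
begin

lemma ord_sign_join_left:
  assumes "v \<in> complex_vertices K" "B \<subseteq> complex_vertices L"
  shows "ord_sign r v (A \<union> B) = ord_sign r v A"
proof -
  have "{u \<in> A \<union> B. r u < r v} = {u \<in> A. r u < r v}" using order assms by fastforce
  then show ?thesis by (simp add: ord_sign_def)
qed

text \<open>All of \<open>A\<close> precedes \<open>v\<close>, which gives the Koszul sign; it does
  not depend on \<open>v\<close> and thus factors out of the boundary sum.\<close>

lemma ord_sign_join_right:
  assumes "v \<in> complex_vertices L" "A \<in> K" "B \<in> L"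
  shows "ord_sign r v (A \<union> B) = (-1) ^ card A * ord_sign r v B"
proof -
  have sub: "A \<subseteq> complex_vertices K" "B \<subseteq> complex_vertices L"
    using assms finite_complexD(6)[OF K] finite_complexD(6)[OF L] by auto
  have "{u \<in> A \<union> B. r u < r v} = A \<union> {u \<in> B. r u < r v}" using order assms sub by auto
  moreover have "card (A \<union> {u \<in> B. r u < r v}) = card A + card {u \<in> B. r u < r v}"
    using assms sub disj finite_complexD(2)[OF K] finite_complexD(2)[OF L]
    by (intro card_Un_disjoint) auto
  ultimately show ?thesis by (simp add: ord_sign_def power_add)
qed

text \<open>The boundary of \<open>c\<close> at \<open>U \<union> B\<close> is the boundary of the
  slice at \<open>U\<close>: a further vertex of \<open>L\<close> would enlarge \<open>B\<close>
  beyond the maximal size \<open>d\<^sub>2\<close>, so it contributes nothing.\<close>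

lemma cycles_join_slice_left:
  assumes c: "c \<in> cycles r a i (complex_join K L) (d\<^sub>1 + d\<^sub>2)" and B: "B \<in> L" "card B = d\<^sub>2"
  shows "(\<lambda>A. if A \<in> K \<and> card A = d\<^sub>1 then c (A \<union> B) else 0) \<in> cycles r a i K d\<^sub>1" (is "?\<phi> \<in> _")
proof (rule cyclesI)
  let ?VK = "complex_vertices K" and ?VL = "complex_vertices L"
  fix j U assume U: "j \<in> {1..i}" "U \<in> K" "card U + 1 = d\<^sub>1"
  have sub: "U \<subseteq> ?VK" "B \<subseteq> ?VL" using U B finite_complexD(6)[OF K] finite_complexD(6)[OF L] by auto
  have UB: "U \<union> B \<in> complex_join K L" using U B by (intro Un_in_complex_join)
  have "card (U \<union> B) + 1 = d\<^sub>1 + d\<^sub>2"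
    using card_complex_join[OF UB] U B by (simp add: complex_join_trace[OF sub])
  then have "(\<Sum>v\<in>?VK \<union> ?VL - (U \<union> B). ord_sign r v (U \<union> B) * a j v * c (insert v (U \<union> B))) = 0"
    using cycles_boundary[OF c U(1) UB] by (simp add: complex_vertices_join)
  also have "(\<Sum>v\<in>?VK \<union> ?VL - (U \<union> B). ord_sign r v (U \<union> B) * a j v * c (insert v (U \<union> B))) =
      (\<Sum>v\<in>?VK - U. ord_sign r v U * a j v * ?\<phi> (insert v U))"
  proof (rule sum.mono_neutral_cong_right)
    show "finite (?VK \<union> ?VL - (U \<union> B))"
      using finite_complexD(5)[OF K] finite_complexD(5)[OF L] by simp
    show "?VK - U \<subseteq> ?VK \<union> ?VL - (U \<union> B)" using sub disj by auto
    show "\<forall>v\<in>(?VK \<union> ?VL - (U \<union> B)) - (?VK - U).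
        ord_sign r v (U \<union> B) * a j v * c (insert v (U \<union> B)) = 0"
    proof
      fix v assume v: "v \<in> (?VK \<union> ?VL - (U \<union> B)) - (?VK - U)"
      then have vL: "v \<in> ?VL" "v \<notin> B" by auto
      have "insert v B \<notin> L"
        using top(2)[of "insert v B"] B vL finite_complexD(2)[OF L B(1)] by auto
      then have "U \<union> insert v B \<notin> complex_join K L"
        using sub vL by (subst Un_in_complex_join_iff) auto
      then show "ord_sign r v (U \<union> B) * a j v * c (insert v (U \<union> B)) = 0"
        using cycles_outside[OF c] by auto
    qed
    fix v assume v: "v \<in> ?VK - U"
    \<comment> \<open>The slice is 0 on non-faces of \<open>K\<close> by definition;
      \<open>c\<close> has to vanish there as well.\<close>
    have "c (insert v U \<union> B) = 0" if "insert v U \<notin> K"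
    proof -
      have "insert v U \<union> B \<notin> complex_join K L"
        using sub v that by (subst Un_in_complex_join_iff) auto
      then show ?thesis using cycles_outside[OF c] by blast
    qed
    moreover have "card (insert v U) = d\<^sub>1" using U v finite_complexD(2)[OF K] by auto
    ultimately have "c (insert v (U \<union> B)) = ?\<phi> (insert v U)" by auto
    then show "ord_sign r v (U \<union> B) * a j v * c (insert v (U \<union> B)) =
        ord_sign r v U * a j v * ?\<phi> (insert v U)"
      using v sub by (simp add: ord_sign_join_left)
  qed
  finally show "(\<Sum>v\<in>?VK - U. ord_sign r v U * a j v * ?\<phi> (insert v U)) = 0" .
qed auto

text \<open>The mirror image, with maximality of \<open>d\<^sub>1\<close>; the Koszul sign is common
  to all terms and cancels.\<close>

lemma cycles_join_slice_right:
  assumes c: "c \<in> cycles r a i (complex_join K L) (d\<^sub>1 + d\<^sub>2)" and A: "A \<in> K" "card A = d\<^sub>1"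
  shows "(\<lambda>B. if B \<in> L \<and> card B = d\<^sub>2 then c (A \<union> B) else 0) \<in> cycles r a i L d\<^sub>2" (is "?\<phi> \<in> _")
proof (rule cyclesI)
  let ?VK = "complex_vertices K" and ?VL = "complex_vertices L"
  fix j U assume U: "j \<in> {1..i}" "U \<in> L" "card U + 1 = d\<^sub>2"
  have sub: "U \<subseteq> ?VL" "A \<subseteq> ?VK" using U A finite_complexD(6)[OF K] finite_complexD(6)[OF L] by auto
  have AU: "A \<union> U \<in> complex_join K L" using U A by (intro Un_in_complex_join)
  have "card (A \<union> U) + 1 = d\<^sub>1 + d\<^sub>2"
    using card_complex_join[OF AU] U A by (simp add: complex_join_trace[OF sub(2,1)])
  then have "(\<Sum>v\<in>?VK \<union> ?VL - (A \<union> U). ord_sign r v (A \<union> U) * a j v * c (insert v (A \<union> U))) = 0"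
    using cycles_boundary[OF c U(1) AU] by (simp add: complex_vertices_join)
  also have "(\<Sum>v\<in>?VK \<union> ?VL - (A \<union> U). ord_sign r v (A \<union> U) * a j v * c (insert v (A \<union> U))) =
      (\<Sum>v\<in>?VL - U. (-1) ^ card A * (ord_sign r v U * a j v * ?\<phi> (insert v U)))"
  proof (rule sum.mono_neutral_cong_right)
    show "finite (?VK \<union> ?VL - (A \<union> U))"
      using finite_complexD(5)[OF K] finite_complexD(5)[OF L] by simp
    show "?VL - U \<subseteq> ?VK \<union> ?VL - (A \<union> U)" using sub disj by auto
    show "\<forall>v\<in>(?VK \<union> ?VL - (A \<union> U)) - (?VL - U).
        ord_sign r v (A \<union> U) * a j v * c (insert v (A \<union> U)) = 0"
    proof
      fix v assume v: "v \<in> (?VK \<union> ?VL - (A \<union> U)) - (?VL - U)"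
      then have vK: "v \<in> ?VK" "v \<notin> A" by auto
      have "insert v A \<notin> K"
        using top(1)[of "insert v A"] A vK finite_complexD(2)[OF K A(1)] by auto
      then have "insert v A \<union> U \<notin> complex_join K L"
        using sub vK by (subst Un_in_complex_join_iff) auto
      then show "ord_sign r v (A \<union> U) * a j v * c (insert v (A \<union> U)) = 0"
        using cycles_outside[OF c] by auto
    qed
    fix v assume v: "v \<in> ?VL - U"
    have "c (A \<union> insert v U) = 0" if "insert v U \<notin> L"
    proof -
      have "A \<union> insert v U \<notin> complex_join K L"
        using sub v that by (subst Un_in_complex_join_iff) auto
      then show ?thesis using cycles_outside[OF c] by blast
    qed
    moreover have "card (insert v U) = d\<^sub>2" using U v finite_complexD(2)[OF L] by auto
    ultimately have "c (insert v (A \<union> U)) = ?\<phi> (insert v U)" by auto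
    then show "ord_sign r v (A \<union> U) * a j v * c (insert v (A \<union> U)) =
        (-1) ^ card A * (ord_sign r v U * a j v * ?\<phi> (insert v U))"
      using v U A by (simp add: ord_sign_join_right)
  qed
  also have "\<dots> = (-1) ^ card A * (\<Sum>v\<in>?VL - U. ord_sign r v U * a j v * ?\<phi> (insert v U))"
    by (rule sum_distrib_left[symmetric])
  finally show "(\<Sum>v\<in>?VL - U. ord_sign r v U * a j v * ?\<phi> (insert v U)) = 0" by simp
qed auto

definition tensor :: "('a set \<Rightarrow> real) \<Rightarrow> ('a set \<Rightarrow> real) \<Rightarrow> 'a set \<Rightarrow> real" where
  "tensor \<phi> \<psi> T = (if T \<in> complex_join K L
     then \<phi> (T \<inter> complex_vertices K) * \<psi> (T \<inter> complex_vertices L) else 0)"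

lemma tensor_Un:
  assumes "\<phi> \<in> cycles r a i K d\<^sub>1" "\<psi> \<in> cycles r a i L d\<^sub>2"
    "A \<subseteq> complex_vertices K" "B \<subseteq> complex_vertices L"
  shows "tensor \<phi> \<psi> (A \<union> B) = \<phi> A * \<psi> B"
  using cycles_outside[OF assms(1), of A] cycles_outside[OF assms(2), of B]
  unfolding tensor_def Un_in_complex_join_iff[OF assms(3,4)] complex_join_trace[OF assms(3,4)] by auto

text \<open>A Leibniz rule: at \<open>U = A \<union> B\<close> the boundary is
  \<open>\<psi> B\<close> times the boundary of \<open>\<phi>\<close> at \<open>A\<close> plus a
  signed \<open>\<phi> A\<close> times the boundary of \<open>\<psi>\<close> at
  \<open>B\<close>.\<close>

lemma tensor_in_cycles_join:
  assumes \<phi>: "\<phi> \<in> cycles r a i K d\<^sub>1" and \<psi>: "\<psi> \<in> cycles r a i L d\<^sub>2"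
  shows "tensor \<phi> \<psi> \<in> cycles r a i (complex_join K L) (d\<^sub>1 + d\<^sub>2)"
proof (rule cyclesI)
  let ?VK = "complex_vertices K" and ?VL = "complex_vertices L"
  show "tensor \<phi> \<psi> T = 0" if "T \<notin> complex_join K L \<or> card T \<noteq> d\<^sub>1 + d\<^sub>2" for T
  proof (rule ccontr)
    assume "tensor \<phi> \<psi> T \<noteq> 0"
    then have "T \<in> complex_join K L" "\<phi> (T \<inter> ?VK) \<noteq> 0" "\<psi> (T \<inter> ?VL) \<noteq> 0"
      by (auto simp: tensor_def split: if_splits)
    then show False
      using that card_complex_join[of T] cycles_outside[OF \<phi>] cycles_outside[OF \<psi>] by metis
  qed
  fix j U assume U: "j \<in> {1..i}" "U \<in> complex_join K L" "card U + 1 = d\<^sub>1 + d\<^sub>2"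
  define A B where "A = U \<inter> ?VK" and "B = U \<inter> ?VL"
  have AB: "A \<in> K" "B \<in> L" "U = A \<union> B" using U(2) unfolding in_complex_join_iff A_def B_def by auto
  have sub: "A \<subseteq> ?VK" "B \<subseteq> ?VL" by (auto simp: A_def B_def)
  \<comment> \<open>If \<open>A\<close> has the wrong size for a cycle condition, each
    \<open>insert v A\<close> has the wrong size for the support of \<open>\<phi>\<close>.\<close>
  have left: "(\<Sum>v\<in>?VK - A. ord_sign r v A * a j v * \<phi> (insert v A)) = 0"
  proof (cases "card A + 1 = d\<^sub>1")
    case True
    then show ?thesis using cycles_boundary[OF \<phi> U(1) AB(1)] by simp
  next
    case False
    then show ?thesis using cycles_outside[OF \<phi>] finite_complexD(2)[OF K AB(1)]
      by (intro sum.neutral) auto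
  qed
  have right: "(\<Sum>v\<in>?VL - B. ord_sign r v B * a j v * \<psi> (insert v B)) = 0"
  proof (cases "card B + 1 = d\<^sub>2")
    case True
    then show ?thesis using cycles_boundary[OF \<psi> U(1) AB(2)] by simp
  next
    case False
    then show ?thesis using cycles_outside[OF \<psi>] finite_complexD(2)[OF L AB(2)]
      by (intro sum.neutral) auto
  qed
  have "(\<Sum>v\<in>complex_vertices (complex_join K L) - U.
        ord_sign r v U * a j v * tensor \<phi> \<psi> (insert v U)) =
      (\<Sum>v\<in>(?VK - A) \<union> (?VL - B). ord_sign r v U * a j v * tensor \<phi> \<psi> (insert v U))"
    by (rule sum.cong) (use disj in \<open>auto simp: complex_vertices_join A_def B_def\<close>)
  also have "\<dots> = (\<Sum>v\<in>?VK - A. ord_sign r v U * a j v * tensor \<phi> \<psi> (insert v U)) +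
      (\<Sum>v\<in>?VL - B. ord_sign r v U * a j v * tensor \<phi> \<psi> (insert v U))"
    by (rule sum.union_disjoint)
      (use disj finite_complexD(5)[OF K] finite_complexD(5)[OF L] in auto)
  also have "(\<Sum>v\<in>?VK - A. ord_sign r v U * a j v * tensor \<phi> \<psi> (insert v U)) =
      (\<Sum>v\<in>?VK - A. \<psi> B * (ord_sign r v A * a j v * \<phi> (insert v A)))"
  proof (rule sum.cong)
    fix v assume v: "v \<in> ?VK - A"
    have "tensor \<phi> \<psi> (insert v A \<union> B) = \<phi> (insert v A) * \<psi> B"
      by (rule tensor_Un[OF assms]) (use v sub in auto)
    then show "ord_sign r v U * a j v * tensor \<phi> \<psi> (insert v U) =
        \<psi> B * (ord_sign r v A * a j v * \<phi> (insert v A))"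
      using v sub by (simp add: AB(3) ord_sign_join_left)
  qed simp
  also have "\<dots> = 0" using left by (simp flip: sum_distrib_left)
  also have "(\<Sum>v\<in>?VL - B. ord_sign r v U * a j v * tensor \<phi> \<psi> (insert v U)) =
      (\<Sum>v\<in>?VL - B. ((-1) ^ card A * \<phi> A) * (ord_sign r v B * a j v * \<psi> (insert v B)))"
  proof (rule sum.cong)
    fix v assume v: "v \<in> ?VL - B"
    have "tensor \<phi> \<psi> (A \<union> insert v B) = \<phi> A * \<psi> (insert v B)"
      by (rule tensor_Un[OF assms]) (use v sub in auto)
    then show "ord_sign r v U * a j v * tensor \<phi> \<psi> (insert v U) =
        ((-1) ^ card A * \<phi> A) * (ord_sign r v B * a j v * \<psi> (insert v B))"
      using v AB by (simp add: ord_sign_join_right)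
  qed simp
  also have "\<dots> = 0" using right by (simp flip: sum_distrib_left)
  finally show "(\<Sum>v\<in>complex_vertices (complex_join K L) - U.
        ord_sign r v U * a j v * tensor \<phi> \<psi> (insert v U)) = 0" by simp
qed

text \<open>The cycle space of the join is the tensor product of the cycle spaces of the factors.\<close>

lemma coordinates_cycles_join:
  assumes B\<^sub>1: "coordinates (cycles r a i K d\<^sub>1) B\<^sub>1 evaluation" "B\<^sub>1 \<subseteq> {T \<in> K. card T = d\<^sub>1}"
    and B\<^sub>2: "coordinates (cycles r a i L d\<^sub>2) B\<^sub>2 evaluation" "B\<^sub>2 \<subseteq> {T \<in> L. card T = d\<^sub>2}"
  shows "coordinates (cycles r a i (complex_join K L) (d\<^sub>1 + d\<^sub>2)) ((\<lambda>(S, T). S \<union> T) ` (B\<^sub>1 \<times> B\<^sub>2)) evaluation"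
proof (rule coordinatesI)
  fix g :: "'a set \<Rightarrow> real"
  have fin: "finite B\<^sub>1" "finite B\<^sub>2"
    using B\<^sub>1(2) B\<^sub>2(2) finite_complexD(1)[OF K] finite_complexD(1)[OF L] by (auto intro: finite_subset)
  have "\<exists>w. w \<in> cycles r a i K d\<^sub>1 \<and> (\<forall>S'\<in>B\<^sub>1. evaluation S' w = (if S' = S then 1 else 0))" for S
    by (rule coordinates_obtain[OF B\<^sub>1(1), of "\<lambda>S'. if S' = S then 1 else 0"]) blast
  then obtain w\<^sub>1 where w\<^sub>1: "\<And>S. w\<^sub>1 S \<in> cycles r a i K d\<^sub>1"
    "\<And>S S'. S' \<in> B\<^sub>1 \<Longrightarrow> w\<^sub>1 S S' = (if S' = S then 1 else 0)" unfolding evaluation_def by metis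
  have "\<exists>w. w \<in> cycles r a i L d\<^sub>2 \<and> (\<forall>S'\<in>B\<^sub>2. evaluation S' w = (if S' = S then 1 else 0))" for S
    by (rule coordinates_obtain[OF B\<^sub>2(1), of "\<lambda>S'. if S' = S then 1 else 0"]) blast
  then obtain w\<^sub>2 where w\<^sub>2: "\<And>S. w\<^sub>2 S \<in> cycles r a i L d\<^sub>2"
    "\<And>S S'. S' \<in> B\<^sub>2 \<Longrightarrow> w\<^sub>2 S S' = (if S' = S then 1 else 0)" unfolding evaluation_def by metis
  \<comment> \<open>The prescribed values are realized by tensor products of the two dual
    bases.\<close>
  let ?c = "\<lambda>U. \<Sum>p\<in>B\<^sub>1 \<times> B\<^sub>2. g (fst p \<union> snd p) * tensor (w\<^sub>1 (fst p)) (w\<^sub>2 (snd p)) U"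
  have "?c (S \<union> T) = g (S \<union> T)" if "S \<in> B\<^sub>1" "T \<in> B\<^sub>2" for S T
  proof -
    have "S \<subseteq> complex_vertices K" "T \<subseteq> complex_vertices L"
      using that B\<^sub>1(2) B\<^sub>2(2) by (auto intro!: finite_complexD(6)[OF K] finite_complexD(6)[OF L] del: subsetI)
    then have "tensor (w\<^sub>1 (fst p)) (w\<^sub>2 (snd p)) (S \<union> T) = w\<^sub>1 (fst p) S * w\<^sub>2 (snd p) T" for p
      by (rule tensor_Un[OF w\<^sub>1(1) w\<^sub>2(1)])
    then have "?c (S \<union> T) = (\<Sum>p\<in>B\<^sub>1 \<times> B\<^sub>2. if p = (S, T) then g (S \<union> T) else 0)"
      using that by (intro sum.cong refl) (auto simp: w\<^sub>1(2) w\<^sub>2(2))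
    then show ?thesis using that fin by simp
  qed
  moreover have "?c \<in> cycles r a i (complex_join K L) (d\<^sub>1 + d\<^sub>2)"
    by (intro cycles_sum tensor_in_cycles_join w\<^sub>1 w\<^sub>2)
  ultimately show "\<exists>\<phi>. \<phi> \<in> cycles r a i (complex_join K L) (d\<^sub>1 + d\<^sub>2) \<and>
      (\<forall>U\<in>(\<lambda>(S, T). S \<union> T) ` (B\<^sub>1 \<times> B\<^sub>2). evaluation U \<phi> = g U)"
    by (intro exI[of _ ?c]) auto
next
  fix \<phi> \<psi> assume \<phi>: "\<phi> \<in> cycles r a i (complex_join K L) (d\<^sub>1 + d\<^sub>2)"
    and \<psi>: "\<psi> \<in> cycles r a i (complex_join K L) (d\<^sub>1 + d\<^sub>2)"
    and agree: "\<And>U. U \<in> (\<lambda>(S, T). S \<union> T) ` (B\<^sub>1 \<times> B\<^sub>2) \<Longrightarrow> evaluation U \<phi> = evaluation U \<psi>"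
  \<comment> \<open>Uniqueness goes one factor at a time. For \<open>T\<close> in
    \<open>B\<^sub>2\<close> the slices over \<open>K\<close> are cycles that agree on
    \<open>B\<^sub>1\<close>, hence on all top faces of \<open>K\<close>; with \<open>S\<close>
    fixed, the slices over \<open>L\<close> then agree on \<open>B\<^sub>2\<close>.\<close>
  have 1: "\<phi> (S \<union> T) = \<psi> (S \<union> T)" if "S \<in> K" "card S = d\<^sub>1" "T \<in> B\<^sub>2" for S T
  proof -
    have T: "T \<in> L" "card T = d\<^sub>2" using that B\<^sub>2(2) by auto
    have "(\<lambda>A. if A \<in> K \<and> card A = d\<^sub>1 then \<phi> (A \<union> T) else 0) =
        (\<lambda>A. if A \<in> K \<and> card A = d\<^sub>1 then \<psi> (A \<union> T) else 0)"
      by (rule coordinates_unique[OF B\<^sub>1(1) cycles_join_slice_left[OF \<phi> T] cycles_join_slice_left[OF \<psi> T]])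
        (use agree[OF imageI[of "(_, T)"]] that in auto)
    from fun_cong[OF this, of S] show ?thesis using that by simp
  qed
  have 2: "\<phi> (S \<union> T) = \<psi> (S \<union> T)" if "S \<in> K" "card S = d\<^sub>1" "T \<in> L" "card T = d\<^sub>2" for S T
  proof -
    have "(\<lambda>B. if B \<in> L \<and> card B = d\<^sub>2 then \<phi> (S \<union> B) else 0) =
        (\<lambda>B. if B \<in> L \<and> card B = d\<^sub>2 then \<psi> (S \<union> B) else 0)"
      by (rule coordinates_unique[OF B\<^sub>2(1)
          cycles_join_slice_right[OF \<phi> that(1,2)] cycles_join_slice_right[OF \<psi> that(1,2)]])
        (use 1 that in auto)
    from fun_cong[OF this, of T] show ?thesis using that by simp
  qed
  show "\<phi> = \<psi>"
  proof
    fix T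
    show "\<phi> T = \<psi> T"
    proof (cases "T \<in> complex_join K L \<and> card T = d\<^sub>1 + d\<^sub>2")
      case True
      let ?A = "T \<inter> complex_vertices K" and ?B = "T \<inter> complex_vertices L"
      have AB: "?A \<in> K" "?B \<in> L" "?A \<union> ?B = T" using True unfolding in_complex_join_iff by auto
      \<comment> \<open>The two sizes are bounded by \<open>d\<^sub>1\<close> and
        \<open>d\<^sub>2\<close> and add up to \<open>d\<^sub>1 + d\<^sub>2\<close>, so both bounds
        are attained.\<close>
      moreover have "card ?A = d\<^sub>1" "card ?B = d\<^sub>2"
        using True card_complex_join[of T] top(1)[OF AB(1)] top(2)[OF AB(2)] by auto
      ultimately show ?thesis using 2[of ?A ?B] by simp
    next
      case False
      then show ?thesis using cycles_outside[OF \<phi>] cycles_outside[OF \<psi>] by metis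
    qed
  qed
qed

end
end

section \<open>Products of linear forms\<close>

lemma linear_ext_coeff: "linear (\<lambda>x. ext_coeff x U)"
  by (rule linearI) (simp_all add: plus_ext_alg.rep_eq scaleR_ext_alg.rep_eq)

lemma wedge_sign_singleton: "wedge_sign {v} U = (-1) ^ card {u \<in> U. u < v}"
proof -
  have "{(s, t). s \<in> {v} \<and> t \<in> U \<and> t < s} = Pair v ` {u \<in> U. u < v}" by auto
  then show ?thesis by (simp add: wedge_sign_def card_image inj_on_def)
qed

text \<open>The case \<open>a = b\<close> is included, so squares vanish. Generators and generic
  forms both qualify, and facts on sorted products are proved once for them.\<close>

definition anticommuting :: "(nat \<Rightarrow> ext_alg) \<Rightarrow> bool" where
  "anticommuting g \<longleftrightarrow> (\<forall>a b. g a * g b = - (g b * g a))"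

lemma anticommutingD: "anticommuting g \<Longrightarrow> g a * g b = - (g b * g a)"
  unfolding anticommuting_def by blast

lemma anticommuting_square:
  assumes "anticommuting g"
  shows "g a * g a = 0"
proof -
  have "g a * g a + g a * g a = 0"
    by (rule eq_neg_iff_add_eq_0[THEN iffD1, OF anticommutingD[OF assms]])
  then have "2 *\<^sub>R (g a * g a) = 0" by (simp add: scaleR_2)
  then show ?thesis by simp
qed

lemma anticommuting_left_commute:
  assumes "anticommuting g"
  shows "g a * (g b * x) = - (g b * (g a * x))"
proof -
  have "g a * (g b * x) = (g a * g b) * x" by (simp only: mult.assoc)
  also have "\<dots> = - (g b * (g a * x))"
    by (simp only: anticommutingD[OF assms, of a b] mult_minus_left mult.assoc)
  finally show ?thesis .
qed

lemma anticommuting_ext_gen: "anticommuting ext_gen"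
  unfolding anticommuting_def
proof (intro allI)
  fix i j
  show "ext_gen i * ext_gen j = - (ext_gen j * ext_gen i)"
  proof (rule ext_alg_eqI)
    fix U :: "nat set" assume U: "finite U"
    have single: "{u. u = b \<and> u < a} = (if b < a then {b} else {})" for a b :: nat by auto
    have "ext_coeff (ext_gen a * ext_gen b) U =
        (if a \<noteq> b \<and> U = {a, b} then if b < a then - 1 else 1 else 0)" for a b
      using U by (auto simp: ext_coeff_gen_times ext_gen.rep_eq wedge_sign_singleton single)
    then show "ext_coeff (ext_gen i * ext_gen j) U = ext_coeff (- (ext_gen j * ext_gen i)) U"
      by (auto simp: uminus_ext_alg.rep_eq)
  qed
qed

lemma anticommuting_generic_form: "anticommuting (generic_form n \<alpha>)"
  unfolding anticommuting_def
proof (intro allI)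
  fix i j
  have prod: "generic_form n \<alpha> a * generic_form n \<alpha> b =
      (\<Sum>k=1..n. \<Sum>m=1..n. (\<alpha> a k * \<alpha> b m) *\<^sub>R (ext_gen k * ext_gen m))" for a b
    by (simp add: generic_form_def sum_product mult.commute)
  have "(\<Sum>k=1..n. \<Sum>m=1..n. (\<alpha> i k * \<alpha> j m) *\<^sub>R (ext_gen k * ext_gen m)) =
      - (\<Sum>k=1..n. \<Sum>m=1..n. (\<alpha> j m * \<alpha> i k) *\<^sub>R (ext_gen m * ext_gen k))"
    unfolding sum_negf[symmetric]
    by (intro sum.cong refl)
      (subst anticommutingD[OF anticommuting_ext_gen], simp only: scaleR_minus_right mult.commute)
  also have "(\<Sum>k=1..n. \<Sum>m=1..n. (\<alpha> j m * \<alpha> i k) *\<^sub>R (ext_gen m * ext_gen k)) =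
      (\<Sum>m=1..n. \<Sum>k=1..n. (\<alpha> j m * \<alpha> i k) *\<^sub>R (ext_gen m * ext_gen k))"
    by (rule sum.swap)
  finally show "generic_form n \<alpha> i * generic_form n \<alpha> j = - (generic_form n \<alpha> j * generic_form n \<alpha> i)"
    unfolding prod .
qed

text \<open>Each transposition costs a sign. The scalar stays unspecified because these products are
  used through their spans.\<close>

lemma prod_list_insort_anticommuting:
  assumes "anticommuting g"
  obtains s :: real where "g j * prod_list (map g xs) = s *\<^sub>R prod_list (map g (insort j xs))"
proof -
  have "\<exists>s :: real. g j * prod_list (map g xs) = s *\<^sub>R prod_list (map g (insort j xs))"
  proof (induction xs)
    case Nil
    then show ?case by (intro exI[of _ 1]) simp
  next
    case (Cons x xs)
    then obtain s :: real where s: "g j * prod_list (map g xs) = s *\<^sub>R prod_list (map g (insort j xs))"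
      by blast
    show ?case
    proof (cases "j \<le> x")
      case True
      then show ?thesis by (intro exI[of _ 1]) simp
    next
      case False
      have "g j * (g x * prod_list (map g xs)) = - (g x * (g j * prod_list (map g xs)))"
        by (rule anticommuting_left_commute[OF assms])
      then show ?thesis using False s by (intro exI[of _ "- s"]) simp
    qed
  qed
  with that show ?thesis by blast
qed

lemma wedge_set_insert:
  assumes "anticommuting g" "finite S" "j \<notin> S"
  obtains s :: real where "g j * wedge_set g S = s *\<^sub>R wedge_set g (insert j S)"
  using prod_list_insort_anticommuting[OF assms(1), of j "sorted_list_of_set S"] assms(2,3)
  by (auto simp: wedge_set_def)

lemma wedge_set_repeated:
  assumes "anticommuting g" "finite S" "j \<in> S"
  shows "g j * wedge_set g S = 0"
proof -
  have "g j * prod_list (map g xs) = 0" if "j \<in> set xs" for xs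
    using that
  proof (induction xs)
    case (Cons x xs)
    have "g j * (g x * prod_list (map g xs)) = - (g x * (g j * prod_list (map g xs)))"
      by (rule anticommuting_left_commute[OF assms(1)])
    moreover have "g j * (g j * prod_list (map g xs)) = 0"
      by (simp add: anticommuting_square[OF assms(1)] flip: mult.assoc)
    ultimately show ?case using Cons by (cases "x = j") auto
  qed simp
  then show ?thesis using assms by (simp add: wedge_set_def)
qed

text \<open>The minimum is split off because, for \<open>S\<close> meeting \<open>{1..i}\<close>, it
  makes the leading factor one of the first \<open>i\<close> forms.\<close>

lemma wedge_set_Min:
  assumes "finite S" "S \<noteq> {}"
  shows "wedge_set g S = g (Min S) * wedge_set g (S - {Min S})"
  using assms by (simp add: wedge_set_def sorted_list_of_set_nonempty)

definition homogeneous :: "nat \<Rightarrow> nat \<Rightarrow> ext_alg set" where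
  "homogeneous n d = span {ext_basis T | T. T \<subseteq> {1..n} \<and> card T = d}"

lemma linear_mult_left: "linear (\<lambda>x :: ext_alg. a * x)"
  by (rule linearI) (simp_all add: distrib_left)

lemma linear_in_span:
  assumes "linear f" "\<And>x. x \<in> B \<Longrightarrow> f x \<in> span C" "x \<in> span B"
  shows "f x \<in> span C"
proof -
  have "f x \<in> span (f ` B)" using assms(1,3) by (simp add: linear_span_image)
  moreover have "span (f ` B) \<subseteq> span C" using assms(2) by (intro span_minimal) auto
  ultimately show ?thesis by blast
qed

lemma generic_form_times_homogeneous:
  assumes "x \<in> homogeneous n d"
  shows "generic_form n \<alpha> j * x \<in> homogeneous n (Suc d)"
proof -
  have gen: "ext_gen k * ext_basis T \<in> homogeneous n (Suc d)"
    if "k \<in> {1..n}" "T \<subseteq> {1..n}" "card T = d" for k T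
  proof -
    have fin: "finite T" using that finite_subset by blast
    show ?thesis
    proof (cases "k \<in> T")
      case True
      then show ?thesis
        using wedge_set_repeated[OF anticommuting_ext_gen fin] by (simp add: homogeneous_def span_zero)
    next
      case False
      then obtain s :: real where "ext_gen k * ext_basis T = s *\<^sub>R ext_basis (insert k T)"
        using wedge_set_insert[OF anticommuting_ext_gen fin] by blast
      moreover have "ext_basis (insert k T) \<in> homogeneous n (Suc d)"
        unfolding homogeneous_def using that fin False by (intro span_base) auto
      ultimately show ?thesis by (simp add: homogeneous_def span_scale)
    qed
  qed
  have "generic_form n \<alpha> j * ext_basis T \<in> homogeneous n (Suc d)" if "T \<subseteq> {1..n}" "card T = d" for T
    unfolding generic_form_def sum_distrib_right homogeneous_def mult_scaleR_left
    by (intro span_sum span_scale) (rule gen[OF _ that, unfolded homogeneous_def])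
  then have "generic_form n \<alpha> j * x \<in> span {ext_basis T | T. T \<subseteq> {1..n} \<and> card T = Suc d}"
    unfolding homogeneous_def
    by (intro linear_in_span[OF linear_mult_left _ assms[unfolded homogeneous_def]]) blast
  then show ?thesis unfolding homogeneous_def .
qed

lemma wedge_set_generic_form_homogeneous:
  assumes "finite S"
  shows "wedge_set (generic_form n \<alpha>) S \<in> homogeneous n (card S)"
proof -
  have "prod_list (map (generic_form n \<alpha>) xs) \<in> homogeneous n (length xs)" for xs
  proof (induction xs)
    case Nil
    have "(1 :: ext_alg) = ext_basis {}" by (simp add: wedge_set_def)
    then have "1 \<in> {ext_basis T | T. T \<subseteq> {1..n} \<and> card T = 0}" by auto
    then show ?case by (simp add: homogeneous_def span_base)
  next
    case (Cons x xs)
    then show ?case by (simp add: generic_form_times_homogeneous)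
  qed
  from this[of "sorted_list_of_set S"] assms show ?thesis by (simp add: wedge_set_def)
qed

lemma separating_functional:
  fixes F :: "'v :: real_vector set"
  assumes "x \<notin> span F"
  obtains g :: "'v \<Rightarrow> real" where "linear g" "\<And>y. y \<in> F \<Longrightarrow> g y = 0" "g x = 1"
proof -
  obtain B where B: "B \<subseteq> F" "independent B" "F \<subseteq> span B"
    using maximal_independent_subset[of F] by blast
  have x: "x \<notin> span B" using assms span_mono[OF B(1)] by blast
  then have "independent (insert x B)" using B(2) by (rule independent_insertI)
  then obtain g :: "'v \<Rightarrow> real" where g: "linear g" "\<forall>y\<in>insert x B. g y = (if y = x then 1 else 0)"
    using linear_independent_extend[of "insert x B" "\<lambda>y. if y = x then 1 else 0 :: real"] by blast
  have "g y = 0" if "y \<in> B" for y using that g(2) x span_base by fastforce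
  then have "g y = 0" if "y \<in> F" for y
    using linear_eq_0_on_span[OF g(1), of B y] B(3) that by blast
  with g that show ?thesis by simp
qed

text \<open>Invertibility of the matrix, argued dually: the values on the generators of a functional
  that kills all forms give a vector in the kernel, so the functional kills \<open>ext_gen k\<close>
  too.\<close>

lemma ext_gen_in_span_generic_form:
  assumes "generic_matrix n \<alpha>" "k \<in> {1..n}"
  shows "ext_gen k \<in> span (generic_form n \<alpha> ` {1..n})"
proof (rule ccontr)
  assume "\<not> ?thesis"
  then obtain g :: "ext_alg \<Rightarrow> real"
    where g: "linear g" "\<And>y. y \<in> generic_form n \<alpha> ` {1..n} \<Longrightarrow> g y = 0" "g (ext_gen k) = 1"
    using separating_functional by blast
  have "(\<Sum>v\<in>{1..n}. \<alpha> j (id v) * g (ext_gen v)) = 0" if "j \<in> {1..n}" for j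
    using g(2)[of "generic_form n \<alpha> j"] that
    by (simp add: generic_form_def linear_sum[OF g(1)] linear_scale[OF g(1)])
  then have "g (ext_gen k) = 0"
    using generic_matrix_trivial_kernel[OF assms(1), of "{1..n}" id n "\<lambda>v. g (ext_gen v)" k] assms(2) by simp
  with g(3) show False by simp
qed

text \<open>Recording \<open>j \<in> S'\<close> keeps track of the part generated by one given
  form.\<close>

lemma generic_form_times_wedge_set_in_span:
  assumes "S \<subseteq> {1..n}" "j \<in> {1..n}"
  shows "generic_form n \<alpha> j * wedge_set (generic_form n \<alpha>) S
    \<in> span {wedge_set (generic_form n \<alpha>) S' | S'. S' \<subseteq> {1..n} \<and> card S' = Suc (card S) \<and> j \<in> S'}"
proof (cases "j \<in> S")
  case True
  then show ?thesis
    using wedge_set_repeated[OF anticommuting_generic_form] assms finite_subset[OF assms(1)]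
    by (simp add: span_zero)
next
  case False
  have fin: "finite S" using assms finite_subset by blast
  obtain s :: real where "generic_form n \<alpha> j * wedge_set (generic_form n \<alpha>) S =
      s *\<^sub>R wedge_set (generic_form n \<alpha>) (insert j S)"
    using wedge_set_insert[OF anticommuting_generic_form fin False] by blast
  moreover have "wedge_set (generic_form n \<alpha>) (insert j S)
    \<in> span {wedge_set (generic_form n \<alpha>) S' | S'. S' \<subseteq> {1..n} \<and> card S' = Suc (card S) \<and> j \<in> S'}"
    using assms fin False by (intro span_base) auto
  ultimately show ?thesis by (simp add: span_scale)
qed

text \<open>The factors of \<open>ext_basis T\<close> are replaced one at a time by combinations of
  forms. Hence a linear functional is determined in each degree by its values on products of
  forms.\<close>

lemma ext_basis_in_span_generic:
  assumes "generic_matrix n \<alpha>" "T \<subseteq> {1..n}"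
  shows "ext_basis T \<in> span {wedge_set (generic_form n \<alpha>) S | S. S \<subseteq> {1..n} \<and> card S = card T}"
proof -
  let ?F = "\<lambda>d. {wedge_set (generic_form n \<alpha>) S | S. S \<subseteq> {1..n} \<and> card S = d}"
  have "prod_list (map ext_gen xs) \<in> span (?F (length xs))" if "set xs \<subseteq> {1..n}" for xs
    using that
  proof (induction xs)
    case Nil
    have "(1 :: ext_alg) = wedge_set (generic_form n \<alpha>) {}" by (simp add: wedge_set_def)
    then have "1 \<in> ?F 0" by auto
    then show ?case by (simp add: span_base)
  next
    case (Cons x xs)
    let ?y = "prod_list (map ext_gen xs)"
    have y: "?y \<in> span (?F (length xs))" using Cons by simp
    have form: "generic_form n \<alpha> j * ?y \<in> span (?F (Suc (length xs)))" if j: "j \<in> {1..n}" for j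
    proof (rule linear_in_span[OF linear_mult_left _ y])
      fix z assume "z \<in> ?F (length xs)"
      then obtain S where S: "z = wedge_set (generic_form n \<alpha>) S" "S \<subseteq> {1..n}" "card S = length xs" by auto
      have "span {wedge_set (generic_form n \<alpha>) S' | S'. S' \<subseteq> {1..n} \<and> card S' = Suc (card S) \<and> j \<in> S'}
          \<subseteq> span (?F (Suc (length xs)))"
        using S(3) by (intro span_mono) auto
      then show "generic_form n \<alpha> j * z \<in> span (?F (Suc (length xs)))"
        using generic_form_times_wedge_set_in_span[OF S(2) j, of \<alpha>] S(1) by blast
    qed
    have "linear (\<lambda>z :: ext_alg. z * ?y)" by (rule linearI) (simp_all add: distrib_right)
    then have "ext_gen x * ?y \<in> span (?F (Suc (length xs)))"
      by (rule linear_in_span[OF _ _ ext_gen_in_span_generic_form[OF assms(1)]]) (use form Cons.prems in auto)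
    then show ?case by simp
  qed
  from this[of "sorted_list_of_set T"] show ?thesis
    using assms(2) finite_subset[OF assms(2)] by (simp add: wedge_set_def)
qed

section \<open>The lexicographic order\<close>

text \<open>The number whose binary digits, from the most significant one for 1 down to the one for
  \<open>n\<close>, mark the complement of \<open>S\<close>. The complement appears because
  containing the smaller element makes a set lexicographically smaller. A rank in the naturals
  supports both induction and greedy selection.\<close>

definition lex_position :: "nat \<Rightarrow> nat set \<Rightarrow> nat" where
  "lex_position n S = (\<Sum>k\<in>{1..n} - S. 2 ^ (n - k))"

text \<open>The digit at \<open>m\<close> outweighs all later digits together, since the smaller
  powers of 2 add up to less than \<open>2 ^ (n - m)\<close>.\<close>

lemma binary_less:
  assumes "B \<subseteq> {1..n}" "m \<in> B - A" "A - B \<subseteq> {m<..n}" "finite A"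
  shows "(\<Sum>k\<in>A. 2 ^ (n - k)) < (\<Sum>k\<in>B. 2 ^ (n - k) :: nat)"
proof -
  let ?w = "\<lambda>X. \<Sum>k\<in>X. 2 ^ (n - k) :: nat"
  have fin: "finite B" using assms(1) finite_subset by blast
  have m: "m \<le> n" using assms by auto
  have "?w {m<..n} = (\<Sum>e\<in>{..<n - m}. 2 ^ e)"
    by (rule sum.reindex_bij_witness[of _ "\<lambda>e. n - e" "\<lambda>k. n - k"]) auto
  also have "\<dots> < 2 ^ (n - m)"
  proof -
    have "(\<Sum>e\<in>{..<q}. 2 ^ e) < (2 ^ q :: nat)" for q by (induction q) auto
    then show ?thesis .
  qed
  finally have "?w {m<..n} < 2 ^ (n - m)" .
  moreover have "?w (A - B) \<le> ?w {m<..n}" using assms by (intro sum_mono2) auto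
  moreover have "2 ^ (n - m) \<le> ?w (B - A)" using assms(2) fin by (intro member_le_sum) auto
  moreover have "?w A = ?w (A \<inter> B) + ?w (A - B)"
    using sum.Int_Diff[OF assms(4), of "\<lambda>k. 2 ^ (n - k) :: nat" B] .
  moreover have "?w B = ?w (A \<inter> B) + ?w (B - A)"
    using sum.Int_Diff[OF fin, of "\<lambda>k. 2 ^ (n - k) :: nat" A] by (simp add: Int_commute)
  ultimately show ?thesis by linarith
qed

lemma lex_less_Min:
  assumes "lex_less S T" "finite S" "finite T"
  obtains m where "m \<in> S - T" "\<And>k. k < m \<Longrightarrow> k \<in> S \<longleftrightarrow> k \<in> T"
proof -
  let ?D = "sym_diff S T"
  have D: "finite ?D" "?D \<noteq> {}" using assms by (auto simp: lex_less_def)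
  have "Min ?D \<in> S - T" using assms(1) Min_in[OF D] by (auto simp: lex_less_def)
  moreover have "k \<in> S \<longleftrightarrow> k \<in> T" if "k < Min ?D" for k
    using Min_le[OF D(1), of k] that by (meson DiffI UnI1 UnI2 not_less)
  ultimately show ?thesis using that by blast
qed

lemma lex_less_position:
  assumes "lex_less S T" "S \<subseteq> {1..n}" "T \<subseteq> {1..n}"
  shows "lex_position n S < lex_position n T"
proof -
  obtain m where m: "m \<in> S - T" "\<And>k. k < m \<Longrightarrow> k \<in> S \<longleftrightarrow> k \<in> T"
    using lex_less_Min[OF assms(1)] assms(2,3) finite_subset by (metis finite_atLeastAtMost)
  have "k > m" if "k \<in> T - S" for k using that m by (metis DiffD1 DiffD2 linorder_neqE_nat)
  then show ?thesis
    unfolding lex_position_def using m(1) assms(2,3) by (intro binary_less[of _ _ m]) auto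
qed

lemma lex_less_linear:
  assumes "card S = card T" "S \<noteq> T" "finite S" "finite T"
  shows "lex_less S T \<or> lex_less T S"
proof -
  have "Min (sym_diff S T) \<in> sym_diff S T" using assms by (intro Min_in) auto
  then show ?thesis using assms unfolding lex_less_def by (auto simp: Un_commute)
qed

text \<open>Let \<open>t\<close> be in \<open>T\<close> with \<open>t \<le> i\<close>, and
  \<open>m\<close> the first difference. If \<open>t < m\<close> then \<open>t \<in> S\<close>;
  otherwise \<open>m \<in> S\<close> and \<open>m \<le> i\<close>. So among sets of equal size those
  meeting \<open>{1..i}\<close> come first, which ties the order to the part generated by the first
  \<open>i\<close> forms.\<close>

lemma lex_less_meets_initial:
  assumes "lex_less S T" "S \<subseteq> {1..n}" "T \<subseteq> {1..n}" "{1..i} \<inter> T \<noteq> {}"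
  shows "{1..i} \<inter> S \<noteq> {}"
proof -
  obtain m where m: "m \<in> S - T" "\<And>k. k < m \<Longrightarrow> k \<in> S \<longleftrightarrow> k \<in> T"
    using lex_less_Min[OF assms(1)] assms(2,3) finite_subset by (metis finite_atLeastAtMost)
  obtain t where t: "t \<in> {1..i}" "t \<in> T" using assms(4) by blast
  have "t \<in> S \<or> m \<in> {1..i}"
    using m(2)[of t] t m(1) assms(2) by (cases "t < m") auto
  then show ?thesis using m(1) t by auto
qed

section \<open>Shifting and cycles\<close>

lemma ext_coeff_sum: "ext_coeff (sum f A) U = (\<Sum>a\<in>A. ext_coeff (f a) U)"
  by (rule linear_sum[OF linear_ext_coeff])

lemma ext_coeff_scaleR: "ext_coeff (c *\<^sub>R x) U = c * ext_coeff x U"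
  by (simp add: scaleR_ext_alg.rep_eq)

lemma ext_alg_expansion:
  assumes "x \<in> homogeneous n d"
  shows "x = (\<Sum>T\<in>{T. T \<subseteq> {1..n} \<and> card T = d}. ext_coeff x T *\<^sub>R ext_basis T)"
proof -
  let ?A = "{T. T \<subseteq> {1..n} \<and> card T = d}"
  have fin: "finite ?A" by (rule finite_subset[of _ "Pow {1..n}"]) auto
  have "x \<in> span (ext_basis ` ?A)"
    using assms unfolding homogeneous_def by (simp add: image_def Collect_conj_eq Bex_def conj_commute)
  then show ?thesis
  proof (induction rule: span_induct_alt)
    case base
    then show ?case by (simp add: zero_ext_alg.rep_eq)
  next
    case (step c y z)
    then obtain S where S: "y = ext_basis S" "S \<subseteq> {1..n}" "card S = d" by auto
    have "finite S" using S finite_subset by blast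
    then have "(\<Sum>T\<in>?A. ext_coeff y T *\<^sub>R ext_basis T) = (\<Sum>T\<in>?A. if T = S then ext_basis S else 0)"
      by (intro sum.cong refl) (auto simp: S(1) ext_coeff_basis)
    then have y: "(\<Sum>T\<in>?A. ext_coeff y T *\<^sub>R ext_basis T) = y" using fin S by simp
    have "(\<Sum>T\<in>?A. ext_coeff (c *\<^sub>R y + z) T *\<^sub>R ext_basis T) =
        c *\<^sub>R (\<Sum>T\<in>?A. ext_coeff y T *\<^sub>R ext_basis T) + (\<Sum>T\<in>?A. ext_coeff z T *\<^sub>R ext_basis T)"
      by (simp add: plus_ext_alg.rep_eq ext_coeff_scaleR scaleR_add_left sum.distrib scaleR_sum_right)
    then show ?case using y step by simp
  qed
qed

lemma ext_coeff_mult_support: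
  assumes "ext_coeff (x * y) U \<noteq> 0"
  obtains S where "S \<subseteq> U" "ext_coeff x S \<noteq> 0" "ext_coeff y (U - S) \<noteq> 0"
proof -
  have "(\<Sum>S\<in>Pow U. wedge_sign S (U - S) * ext_coeff x S * ext_coeff y (U - S)) \<noteq> 0"
    using assms by (simp add: times_ext_alg.rep_eq wedge_coeff_def)
  then obtain S where "S \<in> Pow U" "wedge_sign S (U - S) * ext_coeff x S * ext_coeff y (U - S) \<noteq> 0"
    by (rule sum.not_neutral_contains_not_neutral)
  then show ?thesis by (intro that) auto
qed

text \<open>Multiplication only enlarges supports, so a product with \<open>ext_basis T\<close> has
  nonzero coefficients only at supersets of \<open>T\<close>; a face cannot contain a
  non-face.\<close>

lemma nonface_ideal_coeff:
  assumes "x \<in> nonface_ideal n K" "U \<in> K" "\<And>S T. T \<in> K \<Longrightarrow> S \<subseteq> T \<Longrightarrow> S \<in> K"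
  shows "ext_coeff x U = 0"
proof (rule linear_eq_0_on_span[OF linear_ext_coeff _ assms(1)[unfolded nonface_ideal_def]])
  fix y assume "y \<in> {a * ext_basis T * b | a T b. a \<in> ext_upto n \<and> b \<in> ext_upto n \<and> T \<subseteq> {1..n} \<and> T \<notin> K}"
  then obtain a b T where y: "y = a * ext_basis T * b" "T \<subseteq> {1..n}" "T \<notin> K" by blast
  have fin: "finite T" using y finite_subset by blast
  show "ext_coeff y U = 0"
  proof (rule ccontr)
    assume "ext_coeff y U \<noteq> 0"
    then obtain S where S: "S \<subseteq> U" "ext_coeff (a * ext_basis T) S \<noteq> 0"
      unfolding y(1) by (rule ext_coeff_mult_support)
    then obtain R where R: "R \<subseteq> S" "ext_coeff (ext_basis T) (S - R) \<noteq> 0"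
      by (elim ext_coeff_mult_support)
    then have "T = S - R" using fin by (simp add: ext_coeff_basis split: if_splits)
    then have "T \<subseteq> U" using S by auto
    then show False using assms(2,3) y(3) by blast
  qed
qed

text \<open>A homogeneous element without face coefficients is a combination of the
  \<open>ext_basis T\<close> with \<open>T\<close> a non-face, each of them a generator of the ideal
  with both cofactors 1. Congruence thus becomes a condition on coefficients.\<close>

lemma homogeneous_in_nonface_ideal_iff:
  assumes "x \<in> homogeneous n d" "\<And>S T. T \<in> K \<Longrightarrow> S \<subseteq> T \<Longrightarrow> S \<in> K"
  shows "x \<in> nonface_ideal n K \<longleftrightarrow> (\<forall>T\<in>K. card T = d \<longrightarrow> ext_coeff x T = 0)"
proof
  assume "x \<in> nonface_ideal n K"
  then show "\<forall>T\<in>K. card T = d \<longrightarrow> ext_coeff x T = 0"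
    using nonface_ideal_coeff[of x n K] assms(2) by blast
next
  assume *: "\<forall>T\<in>K. card T = d \<longrightarrow> ext_coeff x T = 0"
  have one: "1 \<in> ext_upto n"
    unfolding ext_upto_def by (rule span_base, rule image_eqI[of _ _ "{}"]) (auto simp: wedge_set_def)
  have "ext_coeff x T *\<^sub>R ext_basis T \<in> nonface_ideal n K" if "T \<subseteq> {1..n}" "card T = d" for T
  proof (cases "T \<in> K")
    case True
    then show ?thesis using * that by (simp add: nonface_ideal_def span_zero)
  next
    case False
    have "\<exists>a T' b. ext_basis T = a * ext_basis T' * b \<and>
        a \<in> ext_upto n \<and> b \<in> ext_upto n \<and> T' \<subseteq> {1..n} \<and> T' \<notin> K"
      by (intro exI[of _ 1] exI[of _ T]) (use one that False in auto)
    then show ?thesis unfolding nonface_ideal_def by (intro span_scale span_base) simp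
  qed
  then have "(\<Sum>T\<in>{T. T \<subseteq> {1..n} \<and> card T = d}. ext_coeff x T *\<^sub>R ext_basis T) \<in> nonface_ideal n K"
    unfolding nonface_ideal_def by (intro span_sum) auto
  then show "x \<in> nonface_ideal n K" using ext_alg_expansion[OF assms(1)] by simp
qed

text \<open>Elements are added in order of increasing rank, so each new one lies outside the span of
  those before it. Ties of \<open>f\<close> are possible, hence the comparison with all other
  elements of rank at most \<open>f S\<close>.\<close>

lemma independent_greedy:
  fixes u :: "'s \<Rightarrow> 'v :: real_vector" and f :: "'s \<Rightarrow> nat"
  assumes "finite D" "\<And>S. S \<in> D \<Longrightarrow> u S \<notin> span (u ` {S' \<in> D. S' \<noteq> S \<and> f S' \<le> f S})"
  shows "independent (u ` D) \<and> inj_on u D"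
proof -
  have "E \<subseteq> D \<longrightarrow> independent (u ` E) \<and> inj_on u E" if "finite E" for E
    using that
  proof (induction E rule: finite_ranking_induct[where f = f])
    case empty
    then show ?case by (simp add: independent_empty)
  next
    case (insert x E)
    show ?case
    proof (cases "x \<in> E")
      case True
      then show ?thesis using insert by (simp add: insert_absorb)
    next
      case False
      show ?thesis
      proof
        assume sub: "insert x E \<subseteq> D"
        then have "u ` E \<subseteq> u ` {S' \<in> D. S' \<noteq> x \<and> f S' \<le> f x}" using insert False by auto
        then have x: "u x \<notin> span (u ` E)" using assms(2)[of x] sub span_mono by blast
        then have "u x \<notin> u ` E" using span_base by blast
        then show "independent (u ` insert x E) \<and> inj_on u (insert x E)"
          using insert sub independent_insertI[OF x] by auto
      qed
    qed
  qed
  then show ?thesis using assms(1) by blast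
qed

section \<open>Chains as functionals on the degree \<open>d\<close> part of the exterior face
  algebra\<close>

context
  fixes K :: "'a set set" and l :: "'a \<Rightarrow> nat" and n d :: nat and \<alpha> :: "nat \<Rightarrow> nat \<Rightarrow> real"
  assumes K: "finite_complex K" and inj: "inj_on l (complex_vertices K)"
    and range: "l ` complex_vertices K \<subseteq> {1..n}" and generic: "generic_matrix n \<alpha>"
begin

abbreviation faces :: "'a set set" where
  "faces \<equiv> {T \<in> K. card T = d}"

abbreviation form :: "nat \<Rightarrow> ext_alg" where
  "form \<equiv> generic_form n \<alpha>"

abbreviation weight :: "nat \<Rightarrow> 'a \<Rightarrow> real" where
  "weight \<equiv> \<lambda>j v. \<alpha> j (l v)"

text \<open>Only coefficients at faces enter, so the functional attached to a chain factors through
  the quotient by the ideal.\<close>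

definition pairing :: "('a set \<Rightarrow> real) \<Rightarrow> ext_alg \<Rightarrow> real" where
  "pairing \<phi> x = (\<Sum>T\<in>faces. \<phi> T * ext_coeff x (l ` T))"

text \<open>For homogeneous elements of degree \<open>d\<close>, the canonical representative modulo
  the ideal: spans in the quotient become spans in \<open>ext_alg\<close>.\<close>

definition face_part :: "ext_alg \<Rightarrow> ext_alg" where
  "face_part x = (\<Sum>T\<in>faces. ext_coeff x (l ` T) *\<^sub>R ext_basis (l ` T))"

lemma label_face:
  assumes "T \<in> K"
  shows "l ` T \<subseteq> {1..n}" "card (l ` T) = card T" "finite (l ` T)" "inj_on l T"
proof -
  have T: "T \<subseteq> complex_vertices K" "finite T" using finite_complexD(2,6)[OF K] assms by auto
  show "inj_on l T" using inj_on_subset[OF inj T(1)] .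
  then show "card (l ` T) = card T" by (rule card_image)
  show "l ` T \<subseteq> {1..n}" "finite (l ` T)" using T range by auto
qed

lemma label_face_eq_iff: "S \<in> K \<Longrightarrow> T \<in> K \<Longrightarrow> l ` S = l ` T \<longleftrightarrow> S = T"
  using inj_on_image_eq_iff[OF inj] finite_complexD(6)[OF K] by blast

lemma linear_pairing: "linear (pairing \<phi>)"
  by (rule linearI)
    (simp_all add: pairing_def plus_ext_alg.rep_eq scaleR_ext_alg.rep_eq sum.distrib
      sum_distrib_left distrib_left mult.left_commute)

lemma linear_face_part: "linear face_part"
  by (rule linearI)
    (simp_all add: face_part_def plus_ext_alg.rep_eq scaleR_ext_alg.rep_eq sum.distrib
      scaleR_add_left scaleR_sum_right)

lemma pairing_basis:
  assumes "T \<in> faces"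
  shows "pairing \<phi> (ext_basis (l ` T)) = \<phi> T"
proof -
  have "pairing \<phi> (ext_basis (l ` T)) = (\<Sum>S\<in>faces. if S = T then \<phi> T else 0)"
    unfolding pairing_def
    by (intro sum.cong refl) (use assms label_face label_face_eq_iff in \<open>auto simp: ext_coeff_basis\<close>)
  then show ?thesis using assms finite_complexD(1)[OF K] by simp
qed

lemma ext_coeff_face_part:
  assumes "T \<in> faces"
  shows "ext_coeff (face_part x) (l ` T) = ext_coeff x (l ` T)"
proof -
  have "ext_coeff (face_part x) (l ` T) = (\<Sum>S\<in>faces. if S = T then ext_coeff x (l ` T) else 0)"
    unfolding face_part_def ext_coeff_sum ext_coeff_scaleR
    by (intro sum.cong refl) (use assms label_face label_face_eq_iff in \<open>auto simp: ext_coeff_basis\<close>)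
  then show ?thesis using assms finite_complexD(1)[OF K] by simp
qed

lemma pairing_face_part: "pairing \<phi> (face_part x) = pairing \<phi> x"
  unfolding pairing_def by (intro sum.cong refl) (simp add: ext_coeff_face_part)

lemma face_part_eq_0_iff: "face_part x = 0 \<longleftrightarrow> (\<forall>T\<in>faces. ext_coeff x (l ` T) = 0)"
proof
  assume "face_part x = 0"
  then show "\<forall>T\<in>faces. ext_coeff x (l ` T) = 0"
    using ext_coeff_face_part[of _ x] by (simp add: zero_ext_alg.rep_eq)
qed (simp add: face_part_def)

lemma ext_coeff_form_times:
  assumes "T \<in> K"
  shows "ext_coeff (form j * x) (l ` T) =
    (\<Sum>v\<in>T. weight j v * (ord_sign l v (T - {v}) * ext_coeff x (l ` (T - {v}))))"
proof -
  note T = label_face[OF assms]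
  have fT: "finite T" using finite_complexD(2)[OF K assms] .
  have "ext_coeff (form j * x) (l ` T) = (\<Sum>k=1..n. \<alpha> j k * ext_coeff (ext_gen k * x) (l ` T))"
    by (simp add: generic_form_def sum_distrib_right ext_coeff_sum ext_coeff_scaleR)
  also have "\<dots> = (\<Sum>k\<in>l ` T. \<alpha> j k * (wedge_sign {k} (l ` T - {k}) * ext_coeff x (l ` T - {k})))"
    using T by (intro sum.mono_neutral_cong_right) (auto simp: ext_coeff_gen_times)
  also have "\<dots> = (\<Sum>v\<in>T. weight j v * (wedge_sign {l v} (l ` T - {l v}) * ext_coeff x (l ` T - {l v})))"
    using T by (simp add: sum.reindex)
  also have "\<dots> = (\<Sum>v\<in>T. weight j v * (ord_sign l v (T - {v}) * ext_coeff x (l ` (T - {v}))))"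
  proof (intro sum.cong refl)
    fix v assume v: "v \<in> T"
    have diff: "l ` T - {l v} = l ` (T - {v})" using T(4) v by (auto dest: inj_onD)
    have "{u \<in> l ` (T - {v}). u < l v} = l ` {u \<in> T - {v}. l u < l v}" by auto
    moreover have "inj_on l {u \<in> T - {v}. l u < l v}" by (rule inj_on_subset[OF T(4)]) auto
    ultimately have "wedge_sign {l v} (l ` (T - {v})) = ord_sign l v (T - {v})"
      by (simp add: wedge_sign_singleton ord_sign_def card_image)
    then show "weight j v * (wedge_sign {l v} (l ` T - {l v}) * ext_coeff x (l ` T - {l v})) =
        weight j v * (ord_sign l v (T - {v}) * ext_coeff x (l ` (T - {v})))"
      by (simp add: diff)
  qed
  finally show ?thesis .
qed

text \<open>The boundary operators defining \<^const>\<open>cycles\<close> are adjoint to multiplication by linear forms.\<close>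

lemma pairing_form_times:
  assumes \<phi>: "\<forall>T. T \<notin> faces \<longrightarrow> \<phi> T = 0"
  shows "pairing \<phi> (form j * x) =
    (\<Sum>U\<in>{U \<in> K. card U + 1 = d}. ext_coeff x (l ` U) *
      (\<Sum>v\<in>complex_vertices K - U. ord_sign l v U * weight j v * \<phi> (insert v U)))"
proof -
  let ?W = "{U \<in> K. card U + 1 = d}" and ?V = "complex_vertices K"
  note KD = finite_complexD[OF K]
  let ?h = "\<lambda>U v. ext_coeff x (l ` U) * (ord_sign l v U * weight j v * \<phi> (insert v U))"
  have "pairing \<phi> (form j * x) = (\<Sum>T\<in>faces. \<Sum>v\<in>T. ?h (T - {v}) v)"
    unfolding pairing_def
    by (intro sum.cong refl) (auto simp: ext_coeff_form_times sum_distrib_left insert_absorb mult_ac intro!: sum.cong)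
  also have "\<dots> = (\<Sum>(T, v)\<in>Sigma faces (\<lambda>T. T). ?h (T - {v}) v)"
    using KD by (intro sum.Sigma) auto
  also have "\<dots> = (\<Sum>(U, v)\<in>Sigma ?W (\<lambda>U. ?V - U). ?h U v)"
  \<comment> \<open>Pairs \<open>(T, v)\<close> correspond to \<open>(T - {v}, v)\<close>. The
    right-hand side has further pairs, whose \<open>insert v U\<close> is no face; they form the
    neutral set, where \<open>\<phi>\<close> is 0.\<close>
  proof (rule sum.reindex_bij_witness_not_neutral[where S' = "{}"
        and T' = "{(U, v) \<in> Sigma ?W (\<lambda>U. ?V - U). insert v U \<notin> faces}"
        and i = "\<lambda>(U, v). (insert v U, v)" and j = "\<lambda>(T, v). (T - {v}, v)"], goal_cases)
    case 2
    show ?case by (rule finite_subset[of _ "K \<times> ?V"]) (use KD in auto)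
  next
    case (4 p)
    obtain T v where p: "p = (T, v)" by force
    with 4 have T: "T \<in> K" "card T = d" "v \<in> T" by auto
    have "finite T" "T \<subseteq> ?V" "T - {v} \<in> K"
      using KD(2)[OF T(1)] KD(6)[OF T(1)] KD(4)[OF T(1), of "T - {v}"] by auto
    moreover have "card (T - {v}) + 1 = d"
      using T \<open>finite T\<close> by (metis Suc_eq_plus1 card.remove)
    ultimately show ?case using T p by (auto simp: insert_absorb)
  next
    case (8 p)
    then show ?case using \<phi> by auto
  qed (use KD in \<open>auto simp: insert_absorb\<close>)
  also have "\<dots> = (\<Sum>U\<in>?W. \<Sum>v\<in>?V - U. ?h U v)"
    using KD by (intro sum.Sigma[symmetric]) auto
  finally show ?thesis by (simp add: sum_distrib_left)
qed

text \<open>Forwards, the smallest element of \<open>S\<close> is at most \<open>i\<close>, so one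
  of the first \<open>i\<close> forms can be split off. Backwards, the boundary at \<open>U\<close>
  is the value on form \<open>j\<close> times the basis element of \<open>U\<close>; expanding the
  latter in products of forms leaves only products containing form \<open>j\<close>.\<close>

lemma cycles_iff_pairing:
  assumes \<phi>: "\<forall>T. T \<notin> faces \<longrightarrow> \<phi> T = 0" and i: "i \<le> n"
  shows "\<phi> \<in> cycles l weight i K d \<longleftrightarrow>
    (\<forall>S. S \<subseteq> {1..n} \<and> card S = d \<and> {1..i} \<inter> S \<noteq> {} \<longrightarrow> pairing \<phi> (wedge_set form S) = 0)"
proof
  assume c: "\<phi> \<in> cycles l weight i K d"
  show "\<forall>S. S \<subseteq> {1..n} \<and> card S = d \<and> {1..i} \<inter> S \<noteq> {} \<longrightarrow> pairing \<phi> (wedge_set form S) = 0"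
  proof (intro allI impI)
    fix S assume S: "S \<subseteq> {1..n} \<and> card S = d \<and> {1..i} \<inter> S \<noteq> {}"
    have fin: "finite S" and ne: "S \<noteq> {}" using S finite_subset by auto
    obtain s where s: "s \<in> {1..i}" "s \<in> S" using S by blast
    have m: "Min S \<in> {1..i}" using Min_in[OF fin ne] Min_le[OF fin s(2)] S s by auto
    show "pairing \<phi> (wedge_set form S) = 0"
      unfolding wedge_set_Min[OF fin ne] pairing_form_times[OF \<phi>]
      by (rule sum.neutral) (use cycles_boundary[OF c m] in auto)
  qed
next
  assume *: "\<forall>S. S \<subseteq> {1..n} \<and> card S = d \<and> {1..i} \<inter> S \<noteq> {} \<longrightarrow> pairing \<phi> (wedge_set form S) = 0"
  show "\<phi> \<in> cycles l weight i K d"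
  proof (rule cyclesI)
    show "\<phi> T = 0" if "T \<notin> K \<or> card T \<noteq> d" for T using \<phi> that by auto
    fix j U assume j: "j \<in> {1..i}" and U: "U \<in> K" "card U + 1 = d"
    let ?row = "\<lambda>U. \<Sum>v\<in>complex_vertices K - U. ord_sign l v U * weight j v * \<phi> (insert v U)"
    have lin: "linear (\<lambda>x. pairing \<phi> (form j * x))"
      using linear_compose[OF linear_mult_left[of "form j"] linear_pairing[of \<phi>]] by (simp add: o_def)
    have "pairing \<phi> (form j * ext_basis (l ` U)) = 0"
    proof (rule linear_eq_0_on_span[OF lin _ ext_basis_in_span_generic[OF generic label_face(1)[OF U(1)]]])
      fix x assume "x \<in> {wedge_set form S | S. S \<subseteq> {1..n} \<and> card S = card (l ` U)}"
      then obtain S where S: "x = wedge_set form S" "S \<subseteq> {1..n}" "card S = card U"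
        using label_face(2)[OF U(1)] by auto
      have "j \<in> {1..n}" using j i by auto
      show "pairing \<phi> (form j * x) = 0"
        unfolding S(1)
      proof (rule linear_eq_0_on_span[OF linear_pairing _ generic_form_times_wedge_set_in_span[OF S(2) \<open>j \<in> {1..n}\<close>]])
        fix y assume "y \<in> {wedge_set form S' | S'. S' \<subseteq> {1..n} \<and> card S' = Suc (card S) \<and> j \<in> S'}"
        then obtain S' where S': "y = wedge_set form S'" "S' \<subseteq> {1..n}" "card S' = Suc (card S)" "j \<in> S'"
          by blast
        have "{1..i} \<inter> S' \<noteq> {}" using j S'(4) by blast
        moreover have "card S' = d" using S'(3) S(3) U(2) by simp
        ultimately show "pairing \<phi> y = 0" using * S'(1,2) by blast
      qed
    qed
    \<comment> \<open>The basis element of \<open>U\<close> has a single nonzero coefficient, which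
      isolates one row of the adjoint formula.\<close>
    also have "pairing \<phi> (form j * ext_basis (l ` U)) =
        (\<Sum>U'\<in>{U \<in> K. card U + 1 = d}. if U' = U then ?row U else 0)"
      unfolding pairing_form_times[OF \<phi>]
      by (intro sum.cong refl)
        (use U label_face(3) label_face_eq_iff in \<open>auto simp: ext_coeff_basis\<close>)
    finally show "?row U = 0" using U finite_complexD(1)[OF K] by simp
  qed
qed

text \<open>All products involved are homogeneous of degree \<open>d\<close>, where congruence
  modulo the ideal is equality of face parts; linearity then moves the span through
  \<open>face_part\<close>.\<close>

lemma shift_matrix_iff:
  assumes "S \<subseteq> {1..n}" "card S = d"
  shows "S \<in> shift_matrix n \<alpha> ((`) l ` K) \<longleftrightarrow>
    face_part (wedge_set form S) \<notin> span ((\<lambda>S'. face_part (wedge_set form S')) `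
      {S'. S' \<subseteq> {1..n} \<and> card S' = d \<and> lex_less S' S})"
proof -
  let ?E = "{S'. S' \<subseteq> {1..n} \<and> card S' = d \<and> lex_less S' S}"
  have E: "{wedge_set form S' | S'. S' \<subseteq> {1..n} \<and> card S' = card S \<and> lex_less S' S} = wedge_set form ` ?E"
    using assms by auto
  have down: "B \<in> (`) l ` K" if "A \<in> (`) l ` K" "B \<subseteq> A" for A B
    using that finite_complexD(4)[OF K] by (auto simp: subset_image_iff)
  have hom: "wedge_set form S' \<in> homogeneous n d" if "S' \<subseteq> {1..n}" "card S' = d" for S'
    using wedge_set_generic_form_homogeneous[of S' n \<alpha>] that finite_subset by auto
  have ideal: "wedge_set form S - w \<in> nonface_ideal n ((`) l ` K) \<longleftrightarrow>
      face_part (wedge_set form S) = face_part w" if w: "w \<in> span (wedge_set form ` ?E)" for w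
  proof -
    have "span (wedge_set form ` ?E) \<subseteq> homogeneous n d"
      unfolding homogeneous_def
      by (rule span_minimal) (use hom in \<open>auto simp: homogeneous_def\<close>)
    then have "wedge_set form S - w \<in> homogeneous n d"
      using w hom[OF assms] unfolding homogeneous_def by (intro span_diff) auto
    then have "wedge_set form S - w \<in> nonface_ideal n ((`) l ` K) \<longleftrightarrow>
        (\<forall>T\<in>(`) l ` K. card T = d \<longrightarrow> ext_coeff (wedge_set form S - w) T = 0)"
      by (rule homogeneous_in_nonface_ideal_iff) (use down in blast)
    also have "\<dots> \<longleftrightarrow> (\<forall>T\<in>faces. ext_coeff (wedge_set form S - w) (l ` T) = 0)"
      using label_face(2) by auto
    also have "\<dots> \<longleftrightarrow> face_part (wedge_set form S - w) = 0"
      by (rule face_part_eq_0_iff[symmetric])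
    also have "\<dots> \<longleftrightarrow> face_part (wedge_set form S) = face_part w"
      by (simp add: linear_diff[OF linear_face_part])
    finally show ?thesis .
  qed
  have "S \<in> shift_matrix n \<alpha> ((`) l ` K) \<longleftrightarrow>
      \<not> (\<exists>w\<in>span (wedge_set form ` ?E). face_part (wedge_set form S) = face_part w)"
    unfolding shift_matrix_def mem_Collect_eq E using assms(1) ideal by blast
  also have "\<dots> \<longleftrightarrow> face_part (wedge_set form S) \<notin> face_part ` span (wedge_set form ` ?E)"
    by blast
  also have "face_part ` span (wedge_set form ` ?E) = span ((\<lambda>S'. face_part (wedge_set form S')) ` ?E)"
    unfolding linear_span_image[OF linear_face_part, symmetric] image_image ..
  finally show ?thesis .
qed

lemma lex_induct:
  assumes "S \<subseteq> {1..n}" "card S = d"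
    and "\<And>S. S \<subseteq> {1..n} \<Longrightarrow> card S = d \<Longrightarrow>
      (\<And>S'. S' \<subseteq> {1..n} \<Longrightarrow> card S' = d \<Longrightarrow> lex_less S' S \<Longrightarrow> P S') \<Longrightarrow> P S"
  shows "P S"
  using assms(1,2)
proof (induction S rule: measure_induct_rule[where f = "lex_position n"])
  case (less S)
  show ?case
    by (rule assms(3)[OF less.prems]) (use less lex_less_position in blast)
qed

text \<open>Values on the products over the shift can be prescribed because their face parts are
  independent, and they determine the rest because every other product depends on earlier ones
  modulo the ideal.\<close>

lemma coordinates_cycles_shift:
  assumes i: "i \<le> n"
  shows "coordinates (cycles l weight i K d)
    {S \<in> shift_matrix n \<alpha> ((`) l ` K). {1..i} \<inter> S = {} \<and> card S = d}
    (\<lambda>S \<phi>. pairing \<phi> (wedge_set form S))"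
proof (rule coordinatesI)
  let ?u = "\<lambda>S. face_part (wedge_set form S)"
  let ?E = "\<lambda>S. {S'. S' \<subseteq> {1..n} \<and> card S' = d \<and> lex_less S' S}"
  \<comment> \<open>\<open>D\<close> also keeps the sets that meet \<open>{1..i}\<close>: the
    functional built below has to be set to 0 on them.\<close>
  define D where "D = {S \<in> shift_matrix n \<alpha> ((`) l ` K). card S = d}"
  have D: "S \<in> D \<longleftrightarrow> S \<subseteq> {1..n} \<and> card S = d \<and> ?u S \<notin> span (?u ` ?E S)" for S
    using shift_matrix_iff[of S] by (auto simp: D_def shift_matrix_def)
  have sub: "S \<subseteq> {1..n}" "card S = d" if "S \<in> D" for S using that D by auto
  have finD: "finite D" by (rule finite_subset[of _ "Pow {1..n}"]) (use sub in auto)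
  have indep: "independent (?u ` D) \<and> inj_on ?u D"
  proof (rule independent_greedy[where f = "lex_position n", OF finD])
    fix S assume S: "S \<in> D"
    have "lex_less S' S" if "S' \<in> D" "S' \<noteq> S" "lex_position n S' \<le> lex_position n S" for S'
      using lex_less_linear[of S' S] lex_less_position[of S S' n] that sub[OF S] sub[OF that(1)]
        finite_subset[of _ "{1..n}"] by fastforce
    then have "?u ` {S' \<in> D. S' \<noteq> S \<and> lex_position n S' \<le> lex_position n S} \<subseteq> ?u ` ?E S"
      using sub by blast
    then have "span (?u ` {S' \<in> D. S' \<noteq> S \<and> lex_position n S' \<le> lex_position n S}) \<subseteq> span (?u ` ?E S)"
      by (rule span_mono)
    moreover have "?u S \<notin> span (?u ` ?E S)" using S unfolding D by simp
    ultimately show "?u S \<notin> span (?u ` {S' \<in> D. S' \<noteq> S \<and> lex_position n S' \<le> lex_position n S})"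
      by (rule contra_subsetD)
  qed
  {
    fix g :: "nat set \<Rightarrow> real"
    let ?h = "\<lambda>S. if {1..i} \<inter> S = {} then g S else 0"
    obtain G :: "ext_alg \<Rightarrow> real" where G: "linear G"
      and Gu: "\<forall>x\<in>?u ` D. G x = ?h (inv_into D ?u x)"
      using linear_independent_extend[of "?u ` D" "\<lambda>x. ?h (inv_into D ?u x)"] indep by blast
    have GD: "G (?u S) = ?h S" if "S \<in> D" for S
    proof -
      have "inv_into D ?u (?u S) = S" using indep that by (intro inv_into_f_f) auto
      moreover have "G (?u S) = ?h (inv_into D ?u (?u S))" using Gu that by blast
      ultimately show ?thesis by (simp only:)
    qed
    \<comment> \<open>A product over \<open>S\<close> outside \<open>D\<close> depends on earlier
      ones, which meet \<open>{1..i}\<close> if \<open>S\<close> does; so the value 0 propagates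
      along the order.\<close>
    have G0: "{1..i} \<inter> S \<noteq> {} \<longrightarrow> G (?u S) = 0" if "S \<subseteq> {1..n}" "card S = d" for S
      using that
    proof (rule lex_induct)
      fix S assume S: "S \<subseteq> {1..n}" "card S = d"
        and IH: "\<And>S'. S' \<subseteq> {1..n} \<Longrightarrow> card S' = d \<Longrightarrow> lex_less S' S \<Longrightarrow>
          {1..i} \<inter> S' \<noteq> {} \<longrightarrow> G (?u S') = 0"
      show "{1..i} \<inter> S \<noteq> {} \<longrightarrow> G (?u S) = 0"
      proof
        assume meets: "{1..i} \<inter> S \<noteq> {}"
        show "G (?u S) = 0"
        proof (cases "S \<in> D")
          case True
          then show ?thesis using GD meets by simp
        next
          case False
          then have "?u S \<in> span (?u ` ?E S)" using D S by blast
          then show ?thesis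
          proof (rule linear_eq_0_on_span[OF G, rotated])
            fix x assume "x \<in> ?u ` ?E S"
            then obtain S' where S': "x = ?u S'" "S' \<subseteq> {1..n}" "card S' = d" "lex_less S' S" by blast
            have "{1..i} \<inter> S' \<noteq> {}" by (rule lex_less_meets_initial[OF S'(4,2) S(1) meets])
            then show "G x = 0" using IH S' by blast
          qed
        qed
      qed
    qed
    \<comment> \<open>The values of \<open>G\<close> outside the span of the face basis elements are
      discarded here.\<close>
    define \<phi> where "\<phi> T = (if T \<in> faces then G (ext_basis (l ` T)) else 0)" for T
    have G_pairing: "pairing \<phi> x = G (face_part x)" for x
      by (simp add: pairing_def face_part_def \<phi>_def linear_sum[OF G] linear_scale[OF G] mult.commute)
    have "\<phi> \<in> cycles l weight i K d"
      using cycles_iff_pairing[of \<phi> i, OF _ i] G0 by (simp add: \<phi>_def G_pairing)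
    moreover have "pairing \<phi> (wedge_set form S) = g S" if "S \<in> D" "{1..i} \<inter> S = {}" for S
      using GD[OF that(1)] that(2) by (simp add: G_pairing)
    ultimately show "\<exists>\<phi>. \<phi> \<in> cycles l weight i K d \<and>
      (\<forall>S\<in>{S \<in> shift_matrix n \<alpha> ((`) l ` K). {1..i} \<inter> S = {} \<and> card S = d}.
        pairing \<phi> (wedge_set form S) = g S)"
      by (intro exI[of _ \<phi>]) (auto simp: D_def)
  }
  fix \<phi> \<psi> assume \<phi>: "\<phi> \<in> cycles l weight i K d" and \<psi>: "\<psi> \<in> cycles l weight i K d"
    and agree: "\<And>S. S \<in> {S \<in> shift_matrix n \<alpha> ((`) l ` K). {1..i} \<inter> S = {} \<and> card S = d} \<Longrightarrow>
      pairing \<phi> (wedge_set form S) = pairing \<psi> (wedge_set form S)"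
  have out: "\<forall>T. T \<notin> faces \<longrightarrow> \<phi> T = 0" "\<forall>T. T \<notin> faces \<longrightarrow> \<psi> T = 0"
    using cycles_outside[OF \<phi>] cycles_outside[OF \<psi>] by auto
  let ?\<delta> = "\<lambda>x. pairing \<phi> x - pairing \<psi> x"
  have lin: "linear ?\<delta>" by (intro linear_compose_sub linear_pairing)
  \<comment> \<open>Sets meeting \<open>{1..i}\<close> give 0 for both cycles, those of
    \<open>D\<close> disjoint from it agree by hypothesis, and the rest depends on earlier
    products.\<close>
  have zero: "?\<delta> (wedge_set form S) = 0" if "S \<subseteq> {1..n}" "card S = d" for S
    using that
  proof (rule lex_induct)
    fix S assume S: "S \<subseteq> {1..n}" "card S = d"
      and IH: "\<And>S'. S' \<subseteq> {1..n} \<Longrightarrow> card S' = d \<Longrightarrow> lex_less S' S \<Longrightarrow> ?\<delta> (wedge_set form S') = 0"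
    show "?\<delta> (wedge_set form S) = 0"
    proof (cases "{1..i} \<inter> S = {}")
      case False
      then show ?thesis
        using S \<phi> \<psi> cycles_iff_pairing[of \<phi> i, OF out(1) i] cycles_iff_pairing[of \<psi> i, OF out(2) i] by simp
    next
      case True
      show ?thesis
      proof (cases "S \<in> D")
        case True
        then show ?thesis using agree[of S] \<open>{1..i} \<inter> S = {}\<close> by (simp add: D_def)
      next
        case False
        then have "?u S \<in> span (?u ` ?E S)" using D S by blast
        then have "?\<delta> (?u S) = 0"
        proof (rule linear_eq_0_on_span[OF lin, rotated])
          fix x assume "x \<in> ?u ` ?E S"
          then obtain S' where S': "x = ?u S'" "S' \<subseteq> {1..n}" "card S' = d" "lex_less S' S" by blast
          show "?\<delta> x = 0" unfolding S'(1) pairing_face_part by (rule IH[OF S'(2-4)])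
        qed
        then show ?thesis by (simp add: pairing_face_part)
      qed
    qed
  qed
  show "\<phi> = \<psi>"
  proof
    fix T
    show "\<phi> T = \<psi> T"
    proof (cases "T \<in> faces")
      case True
      then have T: "T \<in> K" "card T = d" by auto
      have "?\<delta> (ext_basis (l ` T)) = 0"
        by (rule linear_eq_0_on_span[OF lin _ ext_basis_in_span_generic[OF generic label_face(1)[OF T(1)]]])
          (use zero label_face(2)[OF T(1)] T(2) in auto)
      then show ?thesis using pairing_basis[OF True] by simp
    next
      case False
      then show ?thesis using out by simp
    qed
  qed
qed

text \<open>Two coordinate systems on one space are compared in both directions. Linearity of
  \<open>\<kappa>\<close> is assumed twice because the combinations are indexed once by sets of
  numbers and once by the type of \<open>B\<close>, and an assumption cannot be polymorphic in the
  index type.\<close>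

lemma card_shift_eq_coordinates:
  fixes B :: "'b set"
  assumes "i \<le> n" "coordinates (cycles l weight i K d) B \<kappa>" "finite B"
    and lin: "\<And>b (A :: nat set set) c w. \<kappa> b (\<lambda>t. \<Sum>a\<in>A. c a * w a t) = (\<Sum>a\<in>A. c a * \<kappa> b (w a))"
    and lin': "\<And>b (A :: 'b set) c w. \<kappa> b (\<lambda>t. \<Sum>a\<in>A. c a * w a t) = (\<Sum>a\<in>A. c a * \<kappa> b (w a))"
  shows "card {S \<in> shift_matrix n \<alpha> ((`) l ` K). {1..i} \<inter> S = {} \<and> card S = d} = card B"
proof (rule antisym)
  let ?D = "{S \<in> shift_matrix n \<alpha> ((`) l ` K). {1..i} \<inter> S = {} \<and> card S = d}"
  have fin: "finite ?D"
    by (rule finite_subset[of _ "Pow {1..n}"]) (auto simp: shift_matrix_def)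
  have pair: "pairing (\<lambda>t. \<Sum>a\<in>A. c a * w a t) x = (\<Sum>a\<in>A. c a * pairing (w a) x)"
    for A :: "'s set" and c w x
    unfolding pairing_def sum_distrib_left sum_distrib_right by (subst sum.swap) (simp add: mult_ac)
  note D = coordinates_cycles_shift[OF assms(1)]
  show "card ?D \<le> card B"
    by (rule coordinates_card_le[OF D assms(2) fin assms(3)]) (auto intro: cycles_sum simp: pair lin)
  show "card B \<le> card ?D"
    by (rule coordinates_card_le[OF assms(2) D assms(3) fin]) (auto intro: cycles_sum simp: pair lin')
qed

end

section \<open>Joins of shifted complexes\<close>

text \<open>With at least as many forms as vertices no cycle of positive degree survives: for a face
  \<open>insert v U\<close>, the conditions at \<open>U\<close> say that the signed values at the
  sets \<open>insert u U\<close> form a kernel vector of a generic matrix with at least as many rows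
  as columns. In degree 0 the value on the empty face is free.\<close>

lemma coordinates_cycles_full:
  assumes K: "finite_complex K" and "inj_on l (complex_vertices K)" "l ` complex_vertices K \<subseteq> {1..n}"
    and "generic_matrix n \<alpha>" "card (complex_vertices K) \<le> m" "m \<le> n"
  shows "coordinates (cycles r (\<lambda>j v. \<alpha> j (l v)) m K d) (if d = 0 then {{}} else {}) evaluation"
proof (cases "d = 0")
  case True
  have face: "T = {}" if "T \<in> K" "card T = d" for T
    using that True finite_complexD(2)[OF K] by auto
  show ?thesis
  proof (rule coordinatesI)
    fix g :: "'a set \<Rightarrow> real"
    have "(\<lambda>T. if T = {} then g {} else 0) \<in> cycles r (\<lambda>j v. \<alpha> j (l v)) m K d"
      using True face finite_complexD(3)[OF K] by (intro cyclesI) auto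
    then show "\<exists>\<phi>. \<phi> \<in> cycles r (\<lambda>j v. \<alpha> j (l v)) m K d \<and>
        (\<forall>b\<in>if d = 0 then {{}} else {}. evaluation b \<phi> = g b)"
      using True by (intro exI[of _ "\<lambda>T. if T = {} then g {} else 0"]) simp
  next
    fix \<phi> \<psi> assume *: "\<phi> \<in> cycles r (\<lambda>j v. \<alpha> j (l v)) m K d" "\<psi> \<in> cycles r (\<lambda>j v. \<alpha> j (l v)) m K d"
      "\<And>b. b \<in> (if d = 0 then {{}} else {}) \<Longrightarrow> evaluation b \<phi> = evaluation b \<psi>"
    show "\<phi> = \<psi>"
    proof
      fix T
      show "\<phi> T = \<psi> T"
      proof (cases "T = {}")
        case False
        then have "T \<notin> K \<or> card T \<noteq> d" using face by blast
        then show ?thesis using cycles_outside[OF *(1)] cycles_outside[OF *(2)] by simp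
      qed (use *(3)[of "{}"] True in simp)
    qed
  qed
next
  case False
  let ?V = "complex_vertices K"
  have zero: "\<phi> T = 0" if \<phi>: "\<phi> \<in> cycles r (\<lambda>j v. \<alpha> j (l v)) m K d" for \<phi> T
  proof (cases "T \<in> K \<and> card T = d")
    case True
    then have T: "finite T" "T \<subseteq> ?V" "T \<noteq> {}" using False finite_complexD(2,6)[OF K] by auto
    then obtain v where v: "v \<in> T" by auto
    define U where "U = T - {v}"
    have "U \<in> K" using True finite_complexD(4)[OF K, of T U] unfolding U_def by blast
    moreover have "card U + 1 = d"
      using True card.remove[OF T(1) v] unfolding U_def by (metis Suc_eq_plus1)
    moreover have "insert v U = T" "v \<notin> U" using v by (auto simp: U_def)
    ultimately have U: "U \<in> K" "card U + 1 = d" "insert v U = T" "v \<notin> U" .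
    \<comment> \<open>Extended by 0 to the vertices of \<open>U\<close>, so that the kernel lemma
      applies to all of \<open>?V\<close>.\<close>
    let ?\<psi> = "\<lambda>u. if u \<in> U then 0 else ord_sign r u U * \<phi> (insert u U)"
    have "(\<Sum>u\<in>?V. \<alpha> j (l u) * ?\<psi> u) = 0" if j: "j \<in> {1..m}" for j
    proof -
      have "(\<Sum>u\<in>?V. \<alpha> j (l u) * ?\<psi> u) =
          (\<Sum>u\<in>?V - U. ord_sign r u U * \<alpha> j (l u) * \<phi> (insert u U))"
        using finite_complexD(5)[OF K] by (intro sum.mono_neutral_cong_right) auto
      then show ?thesis using cycles_boundary[OF \<phi> j U(1,2)] by simp
    qed
    then have "?\<psi> v = 0"
      using generic_matrix_trivial_kernel[OF assms(4) finite_complexD(5)[OF K] assms(2,3,5,6), of ?\<psi> v]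
        v T(2) by blast
    then show ?thesis using U by (simp add: ord_sign_def)
  next
    case False
    then show ?thesis using cycles_outside[OF \<phi>] by auto
  qed
  have "(\<lambda>_. 0) \<in> cycles r (\<lambda>j v. \<alpha> j (l v)) m K d" by (rule cyclesI) auto
  moreover have "\<phi> = \<psi>" if "\<phi> \<in> cycles r (\<lambda>j v. \<alpha> j (l v)) m K d" "\<psi> \<in> cycles r (\<lambda>j v. \<alpha> j (l v)) m K d"
    for \<phi> \<psi>
    by (rule ext) (simp add: zero[OF that(1)] zero[OF that(2)])
  ultimately show ?thesis
    using False by (intro coordinatesI) (simp_all, blast)
qed

text \<open>
  The dimension of the cycle space is the same for all generic choices, so it can be computed
  with the labels and the matrix chosen for a larger complex.
\<close>

lemma exterior_shift_coordinates:
  assumes K: "finite_complex K" and shift: "is_exterior_shift K D"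
    and inj: "inj_on l (complex_vertices K)" and range: "l ` complex_vertices K \<subseteq> {1..n}"
    and generic: "generic_matrix n \<alpha>" and i: "i \<le> n"
  obtains B where "B \<subseteq> {T \<in> K. card T = d}"
    "coordinates (cycles l (\<lambda>j v. \<alpha> j (l v)) i K d) B evaluation"
    "card {S \<in> D. {1..i} \<inter> S = {} \<and> card S = d} = card B"
proof -
  let ?V = "complex_vertices K"
  obtain n' l' \<beta> where l': "inj_on l' ?V" "l' ` ?V \<subseteq> {1..n'}" "generic_matrix n' \<beta>"
    and D: "D = shift_matrix n' \<beta> ((`) l' ` K)"
    using shift unfolding is_exterior_shift_def by blast
  have finB: "finite B" if "B \<subseteq> {T \<in> K. card T = d}" for B
    using that finite_complexD(1)[OF K] by (auto intro: finite_subset)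
  show ?thesis
  \<comment> \<open>The bound on \<open>i\<close> comes from the larger complex, whereas the given
    shift may have been computed in an ambient \<open>n'\<close> below \<open>i\<close>.\<close>
  proof (cases "i \<le> n'")
    case True
    obtain B where B: "B \<subseteq> {T \<in> K. card T = d}"
      "coordinates (cycles l (\<lambda>j v. \<beta> j (l' v)) i K d) B evaluation"
      "coordinates (cycles l (\<lambda>j v. \<alpha> j (l v)) i K d) B evaluation"
      using cycles_generic_common[OF K True i l'(3,1,2) generic inj range, of d l] .
    have "card {S \<in> D. {1..i} \<inter> S = {} \<and> card S = d} = card B"
      unfolding D
      by (rule card_shift_eq_coordinates[OF K l' True coordinates_cycles_order[OF K inj l'(1) B(2)] finB[OF B(1)]])
        simp_all
    then show ?thesis using that B by blast
  next
    case False
    have "card ?V \<le> n'" using card_inj_on_le[OF l'(1,2)] by simp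
    let ?B = "if d = 0 then {{}} else {} :: 'a set set"
    have B: "?B \<subseteq> {T \<in> K. card T = d}" using finite_complexD(3)[OF K] by auto
    have sub: "S \<subseteq> {1..n'}" if "S \<in> D" for S using that by (auto simp: D shift_matrix_def)
    \<comment> \<open>Members of \<open>D\<close> lie in \<open>{1..n'}\<close>, so for both bounds
      the condition just says \<open>S = {}\<close>. Both cycle spaces then fall under
      \<open>coordinates_cycles_full\<close>.\<close>
    have "{1..i} \<inter> S = {} \<longleftrightarrow> {1..n'} \<inter> S = {}" if "S \<in> D" for S
    proof -
      have "{1..n'} \<subseteq> {1..i}" using False by simp
      then have "{1..i} \<inter> S = S" "{1..n'} \<inter> S = S" using sub[OF that] by blast+
      then show ?thesis by simp
    qed
    then have "{S \<in> D. {1..i} \<inter> S = {} \<and> card S = d} = {S \<in> D. {1..n'} \<inter> S = {} \<and> card S = d}"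
      by auto
    also have "card \<dots> = card ?B"
      unfolding D
      by (rule card_shift_eq_coordinates[OF K l' order_refl
            coordinates_cycles_full[OF K l' \<open>card ?V \<le> n'\<close> order_refl] finB[OF B]]) simp_all
    finally show ?thesis
      using that[OF B coordinates_cycles_full[OF K inj range generic _ i]] \<open>card ?V \<le> n'\<close> False by simp
  qed
qed

lemma Max_card_face:
  assumes "finite_complex K"
  shows "T \<in> K \<Longrightarrow> card T \<le> Max (card ` K)" "\<exists>T\<in>K. card T = Max (card ` K)"
proof -
  have fin: "finite (card ` K)" "card ` K \<noteq> {}" using finite_complexD[OF assms] by auto
  show "T \<in> K \<Longrightarrow> card T \<le> Max (card ` K)" using fin by auto
  show "\<exists>T\<in>K. card T = Max (card ` K)" using Max_in[OF fin] by auto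
qed

lemma Max_card_complex_join:
  assumes K: "finite_complex K" and L: "finite_complex L"
    and disj: "complex_vertices K \<inter> complex_vertices L = {}"
  shows "Max (card ` complex_join K L) = Max (card ` K) + Max (card ` L)"
proof (rule Max_eqI)
  show "finite (card ` complex_join K L)"
    using finite_complexD(1)[OF finite_complex_join[OF assms]] by simp
  show "c \<le> Max (card ` K) + Max (card ` L)" if "c \<in> card ` complex_join K L" for c
    using that card_complex_join[OF assms] in_complex_join_iff[OF assms]
      Max_card_face(1)[OF K] Max_card_face(1)[OF L] by (auto intro!: add_mono)
  obtain S T where ST: "S \<in> K" "card S = Max (card ` K)" "T \<in> L" "card T = Max (card ` L)"
    using Max_card_face(2)[OF K] Max_card_face(2)[OF L] by blast
  have "S \<inter> T = {}" using ST finite_complexD(6)[OF K] finite_complexD(6)[OF L] disj by blast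
  then have "card (S \<union> T) = Max (card ` K) + Max (card ` L)"
    using ST finite_complexD(2)[OF K] finite_complexD(2)[OF L] by (simp add: card_Un_disjoint)
  moreover have "S \<union> T \<in> complex_join K L" using ST by (auto simp: complex_join_def)
  ultimately show "Max (card ` K) + Max (card ` L) \<in> card ` complex_join K L" by (metis imageI)
qed

theorem theorem1p3:
  fixes K L :: "'a set set" and DK DL DKL :: "nat set set" and n i :: nat
  assumes "finite_complex K" and "finite_complex L"
    and "complex_vertices K \<inter> complex_vertices L = {}"
    and "card (complex_vertices (complex_join K L)) = n"
    and "is_exterior_shift K DK"
    and "is_exterior_shift L DL"
    and "is_exterior_shift (complex_join K L) DKL"
    and "i \<in> {1..n}"
  shows "card {S \<in> DKL. {1..i} \<inter> S = {} \<and> int (card S) = complex_dim (complex_join K L) + 1} =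
         card {S \<in> DK. {1..i} \<inter> S = {} \<and> int (card S) = complex_dim K + 1} *
         card {S \<in> DL. {1..i} \<inter> S = {} \<and> int (card S) = complex_dim L + 1}"
proof -
  note K = assms(1) and L = assms(2) and KL = assms(1-3)
  let ?VK = "complex_vertices K" and ?VL = "complex_vertices L" and ?J = "complex_join K L"
  let ?d\<^sub>1 = "Max (card ` K)" and ?d\<^sub>2 = "Max (card ` L)"
  have J: "finite_complex ?J" by (rule finite_complex_join[OF KL])
  have V: "complex_vertices ?J = ?VK \<union> ?VL" by (rule complex_vertices_join[OF KL])
  obtain N l \<alpha> where l: "inj_on l (complex_vertices ?J)" "l ` complex_vertices ?J \<subseteq> {1..N}"
      and \<alpha>: "generic_matrix N \<alpha>" and DKL: "DKL = shift_matrix N \<alpha> ((`) l ` ?J)"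
    using assms(7) unfolding is_exterior_shift_def by blast
  \<comment> \<open>The labels of the join are distinct elements of \<open>{1..N}\<close>, so
    \<open>i\<close> is a legitimate row index of the matrix chosen for the join.\<close>
  have "n \<le> N" using card_inj_on_le[OF l] assms(4) by simp
  then have i: "i \<le> N" using assms(8) by simp
  have lK: "inj_on l ?VK" "l ` ?VK \<subseteq> {1..N}" and lL: "inj_on l ?VL" "l ` ?VL \<subseteq> {1..N}"
    using l unfolding V by (auto intro: inj_on_subset)
  let ?w = "\<lambda>j v. \<alpha> j (l v)"
  obtain B\<^sub>1 where B\<^sub>1: "B\<^sub>1 \<subseteq> {T \<in> K. card T = ?d\<^sub>1}" "coordinates (cycles l ?w i K ?d\<^sub>1) B\<^sub>1 evaluation"
    "card {S \<in> DK. {1..i} \<inter> S = {} \<and> card S = ?d\<^sub>1} = card B\<^sub>1"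
    by (rule exterior_shift_coordinates[OF K assms(5) lK \<alpha> i])
  obtain B\<^sub>2 where B\<^sub>2: "B\<^sub>2 \<subseteq> {T \<in> L. card T = ?d\<^sub>2}" "coordinates (cycles l ?w i L ?d\<^sub>2) B\<^sub>2 evaluation"
    "card {S \<in> DL. {1..i} \<inter> S = {} \<and> card S = ?d\<^sub>2} = card B\<^sub>2"
    by (rule exterior_shift_coordinates[OF L assms(6) lL \<alpha> i])
  \<comment> \<open>The labels \<open>l\<close> may interleave the two vertex sets; adding
    \<open>N\<close> on \<open>?VL\<close> puts all of \<open>?VK\<close> first, as the argument for
    joins requires.\<close>
  define r where "r v = (if v \<in> ?VK then l v else l v + N)" for v
  have order: "r u < r v" if "u \<in> ?VK" "v \<in> ?VL" for u v
  proof -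
    have "v \<notin> ?VK" "l u \<in> {1..N}" "l v \<in> {1..N}" using that assms(3) lK(2) lL(2) by auto
    then show ?thesis using that by (simp add: r_def)
  qed
  have rK: "inj_on r ?VK"
    using lK(1) by (simp add: r_def inj_on_def)
  have "r v = l v + N" if "v \<in> ?VL" for v using that assms(3) by (auto simp: r_def)
  then have rL: "inj_on r ?VL" using lL(1) by (simp add: inj_on_def)
  have "r ` ?VK \<inter> r ` ?VL = {}" using order by (force dest: less_imp_neq)
  then have rJ: "inj_on r (complex_vertices ?J)"
    unfolding V using rK rL by (auto simp: inj_on_Un)
  let ?B = "(\<lambda>(S, T). S \<union> T) ` (B\<^sub>1 \<times> B\<^sub>2)"
  have "coordinates (cycles r ?w i ?J (?d\<^sub>1 + ?d\<^sub>2)) ?B evaluation"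
    by (rule coordinates_cycles_join[OF KL order Max_card_face(1)[OF K] Max_card_face(1)[OF L]
          coordinates_cycles_order[OF K lK(1) rK B\<^sub>1(2)] B\<^sub>1(1)
          coordinates_cycles_order[OF L lL(1) rL B\<^sub>2(2)] B\<^sub>2(1)])
  \<comment> \<open>Back to the order of the labels, in which the shift of the join is
    computed.\<close>
  then have B: "coordinates (cycles l ?w i ?J (?d\<^sub>1 + ?d\<^sub>2)) ?B evaluation"
    by (rule coordinates_cycles_order[OF J rJ l(1)])
  have "finite B\<^sub>1" "finite B\<^sub>2"
    using B\<^sub>1(1) B\<^sub>2(1) finite_complexD(1)[OF K] finite_complexD(1)[OF L] by (auto intro: finite_subset)
  then have "finite ?B" by simp
  have "card {S \<in> DKL. {1..i} \<inter> S = {} \<and> card S = ?d\<^sub>1 + ?d\<^sub>2} = card ?B"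
    unfolding DKL by (rule card_shift_eq_coordinates[OF J l \<alpha> i B \<open>finite ?B\<close>]) simp_all
  also have "\<dots> = card B\<^sub>1 * card B\<^sub>2"
    using B\<^sub>1(1) B\<^sub>2(1) by (intro card_image_join[OF KL]) auto
  finally have "card {S \<in> DKL. {1..i} \<inter> S = {} \<and> card S = ?d\<^sub>1 + ?d\<^sub>2} =
      card {S \<in> DK. {1..i} \<inter> S = {} \<and> card S = ?d\<^sub>1} * card {S \<in> DL. {1..i} \<inter> S = {} \<and> card S = ?d\<^sub>2}"
    by (simp only: B\<^sub>1(3) B\<^sub>2(3))
  \<comment> \<open>Face size exceeds dimension by one; if the empty set is the only face, both
    sides say \<open>c = 0\<close>.\<close>
  moreover have "int c = complex_dim M + 1 \<longleftrightarrow> c = Max (card ` M)" for c and M :: "'a set set"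
    by (simp add: complex_dim_def)
  ultimately show ?thesis by (simp only: Max_card_complex_join[OF KL])
qed

end
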